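(* There exist absolute constants $x_0$ and $0<c_1\le c_2$ such that for all real $x\ge x_0$ and all real $\beta$ with $0\le\beta\le\sqrt{\log_2 x}$, both of the following hold: $$c_1\frac{(\beta+1)x}{\sqrt{\log_2 x}}\le \#\{n\le x:\ \omega(n,t)\le \max(0,\log_2 t+\beta)\ \text{ for all real } t \text{ with } 2\le t\le x\}\le c_2\frac{(\beta+1)x}{\sqrt{\log_2 x}}$$ and $$c_1\frac{(\beta+1)x}{\sqrt{\log_2 x}}\le \#\{n\le x:\ \omega(n,t)\ge \log_2 t-\beta\ \text{ for all real } t \text{ with } 2\le t\le x\}\le c_2\frac{(\beta+1)x}{\sqrt{\log_2 x}}.$$
   Context: Notation: $\log_2 y=\log\log y$ (iterated natural logarithm). In the counts $n$ ranges over positive integers. For a positive integer $n$ and real $t$, $\omega(n,t)$ is the number of distinct prime factors of $n$ which are $\le t$. *)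

theory Defs
  imports Complex_Main "HOL-Computational_Algebra.Primes"
begin

definition loglog :: "real \<Rightarrow> real" where
  "loglog y = ln (ln y)"

definition omega :: "nat \<Rightarrow> real \<Rightarrow> nat" where
  "omega n t = card {p \<in> prime_factors n. real p \<le> t}"

definition upper_barrier_set :: "real \<Rightarrow> real \<Rightarrow> nat set" where
  "upper_barrier_set x \<beta> = {n. n \<ge> 1 \<and> real n \<le> x \<and>
     (\<forall>t::real. 2 \<le> t \<and> t \<le> x \<longrightarrow> real (omega n t) \<le> max 0 (loglog t + \<beta>))}"

definition lower_barrier_set :: "real \<Rightarrow> real \<Rightarrow> nat set" where
  "lower_barrier_set x \<beta> = {n. n \<ge> 1 \<and> real n \<le> x \<and>
     (\<forall>t::real. 2 \<le> t \<and> t \<le> x \<longrightarrow> real (omega n t) \<ge> loglog t - \<beta>)}"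

end

theory Submission
  imports Defs "HOL-Real_Asymp.Real_Asymp" "HOL-Number_Theory.Prime_Powers" "HOL-Analysis.Summation_Tests"
begin

text \<open>
  If a set \<open>U\<close> of primes is chosen by including each \<open>p\<close> independently with probability about
  \<open>1/p\<close>, then by Mertens' theorem \<open>\<bar>{p \<in> U. p \<le> t}\<bar> - ln (ln t)\<close> is, up to a bounded drift, a centred
  random walk with steps of length at most 1 and variance about \<open>L = ln (ln x)\<close> at time \<open>x\<close>. Optional
  stopping, applied to a linear and a quadratic martingale, shows that such a walk stays below
  level \<open>d\<close> with probability of order \<open>(d + 1) / sqrt L\<close>.

  For the upper bounds, \<open>ln n\<close> is expanded as a sum of von Mangoldt values over the divisors of \<open>n\<close>;
  cancelling a prime power changes \<open>omega\<close> by at most 1, and Chebyshev's bound reduces the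
  count to the sum of \<open>1/m\<close> over the integers \<open>m \<le> x\<close> with barrier \<open>\<beta> + 2\<close>, that is to the walk. For the
  lower bounds, one counts products \<open>n = P m q\<close>: the prime \<open>q > sqrt x\<close> is free, \<open>m\<close> is a squarefree
  product of primes in \<open>(T, x\<^sup>\<delta>]\<close> obeying a barrier at \<open>\<beta> + 1\<close>, and a fixed \<open>P\<close> (1, or the product
  of all primes up to \<open>T\<close>) gains the room that absorbs all bounded errors. Rankin's trick together
  with the upper bound for the walk discards the large \<open>m\<close>.
\<close>

text \<open>The integers up to x carry no product structure, because the bound on n couples the
  large prime factors. In the upper bound, the weights 1/m may be summed over all integers composed
  of primes up to x: their total mass is an Euler product of order ln x, like the sum of 1/m over m
  <= x, so dropping the size condition costs only a constant. In the lower bound, q fills whatever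
  room is left, and stopping the walk at x^\<delta> shortens its clock ln (ln x) only by the
  constant -ln \<delta>.

  Bounded errors are harmless above, since (d + 1) / sqrt L changes only by a constant factor when d
  grows by O(1). Below they are not: for \<beta> near 0, a shift of the barrier by a constant could
  leave nothing, and an early violation cannot be repaired. So the primes up to T are prescribed.
  Omitting them gains room ln (ln T) under the upper barrier; taking them all gives a head start of
  order at least ln T over the lower one, far more than ln (ln T). The condition \<beta> <= sqrt L
  is natural, as beyond it a probability of order (\<beta> + 1) / sqrt L saturates.\<close>

section \<open>Random walks below a barrier\<close>

text \<open>\<open>stay s rs d\<close> is the probability that a walk with independent steps, equal to
  \<open>s (1 - r)\<close> with probability \<open>r\<close> and to \<open>- s r\<close> otherwise, never rises above level \<open>d\<close>;
  \<open>s = 1\<close> and \<open>s = -1\<close> give the upper and the lower barrier.\<close>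

fun stay :: "real \<Rightarrow> real list \<Rightarrow> real \<Rightarrow> real" where
  "stay s [] d = (if d < 0 then 0 else 1)"
| "stay s (r # rs) d =
     (if d < 0 then 0 else r * stay s rs (d - s * (1 - r)) + (1 - r) * stay s rs (d + s * r))"

definition walk_var :: "real list \<Rightarrow> real" where
  "walk_var rs = (\<Sum>r\<leftarrow>rs. r * (1 - r))"

lemma walk_var_simps [simp]:
  "walk_var [] = 0" "walk_var (r # rs) = r * (1 - r) + walk_var rs"
  by (simp_all add: walk_var_def)

lemma walk_var_nonneg: "set rs \<subseteq> {0..1} \<Longrightarrow> walk_var rs \<ge> 0"
  by (induction rs) auto

lemma stay_neg [simp]: "d < 0 \<Longrightarrow> stay s rs d = 0"
  by (cases rs) auto

lemma stay_le_1: "set rs \<subseteq> {0..1} \<Longrightarrow> stay s rs d \<le> 1"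
proof (induction rs arbitrary: d)
  case (Cons r rs)
  have "r * stay s rs (d - s * (1 - r)) + (1 - r) * stay s rs (d + s * r) \<le> r * 1 + (1 - r) * 1"
    using Cons by (intro add_mono mult_left_mono) auto
  thus ?case by simp
qed auto

lemma stay_nonneg: "set rs \<subseteq> {0..1} \<Longrightarrow> 0 \<le> stay s rs d"
  by (induction rs arbitrary: d) auto

text \<open>Optional stopping at the exit from \<open>[0, H]\<close>: the right-hand side is a linear plus a
  quadratic martingale, and as steps have length at most 1 it dominates the indicator of
  survival at every exit position.\<close>

lemma stay_le_aux:
  assumes "\<bar>s\<bar> = 1" "H \<ge> 0" "c \<ge> 0" "set rs \<subseteq> {0..1}" "c * walk_var rs \<le> 1" "0 \<le> d" "d \<le> H"
  shows "stay s rs d \<le> (d + 1) / (H + 1) + c * ((d + 1) * (H + 1 - d)) + (1 - c * walk_var rs)"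
  using assms(4-)
proof (induction rs arbitrary: d)
  case Nil
  have "0 \<le> (d + 1) / (H + 1) + c * ((d + 1) * (H + 1 - d))"
    using Nil assms by (intro add_nonneg_nonneg mult_nonneg_nonneg divide_nonneg_nonneg) auto
  thus ?case using Nil by simp
next
  case (Cons r rs)
  define F where "F = (\<lambda>d. (d + 1) / (H + 1) + c * ((d + 1) * (H + 1 - d)) + (1 - c * walk_var rs))"
  have r: "0 \<le> r" "r \<le> 1" and rs: "set rs \<subseteq> {0..1}"
    using Cons.prems by auto
  have s2: "s * s = 1" using assms(1) by (metis abs_mult_self_eq mult_1)
  have "0 \<le> c * (r * (1 - r))" using r assms by auto
  hence v: "c * walk_var rs \<le> 1" using Cons.prems by (simp add: distrib_left)
  have key: "stay s rs e \<le> F e" if e: "- 1 \<le> e" "e \<le> H + 1" for e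
  proof -
    have nn: "0 \<le> c * ((e + 1) * (H + 1 - e))"
      using e assms by (intro mult_nonneg_nonneg) auto
    consider "e < 0" | "0 \<le> e" "e \<le> H" | "H < e" by linarith
    thus ?thesis
    proof cases
      case 1
      have "0 \<le> (e + 1) / (H + 1)" using e assms by auto
      thus ?thesis unfolding F_def using 1 nn v by simp
    next
      case 2
      thus ?thesis unfolding F_def using Cons.IH[OF rs v] by blast
    next
      case 3
      have "1 \<le> (e + 1) / (H + 1)" using 3 assms by (simp add: field_simps)
      thus ?thesis unfolding F_def using nn v stay_le_1[OF rs, of s e] by linarith
    qed
  qed
  have sr: "\<bar>s * r\<bar> \<le> 1" "\<bar>s * (1 - r)\<bar> \<le> 1"
    using assms(1) r by (auto simp: abs_mult)
  have "stay s (r # rs) d = r * stay s rs (d - s * (1 - r)) + (1 - r) * stay s rs (d + s * r)"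
    using Cons.prems by simp
  also have "\<dots> \<le> r * F (d - s * (1 - r)) + (1 - r) * F (d + s * r)"
    using r sr Cons.prems by (intro add_mono mult_left_mono key) auto
  also have "\<dots> = (d + 1) / (H + 1) + c * ((d + 1) * (H + 1 - d)) + (1 - c * walk_var (r # rs))"
  proof -
    have 1: "r * ((d - s * (1 - r) + 1) / (H + 1)) + (1 - r) * ((d + s * r + 1) / (H + 1)) = (d + 1) / (H + 1)"
      using assms(2) by (simp add: divide_simps) algebra
    \<comment> \<open>Averaging over one step lowers the quadratic by exactly the variance r (1 - r)
      of that step. This is the amount by which \<open>walk_var\<close> grows when r is put in front
      of the list.\<close>
    have 2: "r * ((d - s * (1 - r) + 1) * (H + 1 - (d - s * (1 - r)))) +
        (1 - r) * ((d + s * r + 1) * (H + 1 - (d + s * r))) = (d + 1) * (H + 1 - d) - r * (1 - r)"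
      using s2 by algebra
    have "r * F (d - s * (1 - r)) + (1 - r) * F (d + s * r) =
       (r * ((d - s * (1 - r) + 1) / (H + 1)) + (1 - r) * ((d + s * r + 1) / (H + 1))) +
       c * (r * ((d - s * (1 - r) + 1) * (H + 1 - (d - s * (1 - r)))) +
        (1 - r) * ((d + s * r + 1) * (H + 1 - (d + s * r)))) + (1 - c * walk_var rs)"
      unfolding F_def by (simp add: algebra_simps)
    also have "\<dots> = (d + 1) / (H + 1) + c * ((d + 1) * (H + 1 - d) - r * (1 - r)) + (1 - c * walk_var rs)"
      unfolding 1 2 ..
    finally show ?thesis by (simp add: algebra_simps)
  qed
  finally show ?case .
qed

text \<open>Taking c = 1 / \<open>walk_var rs\<close> in \<open>stay_le_aux\<close> removes its
  constant term, and H = \<sigma> - 1 balances the other two: the chance of climbing to the top of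
  the strip, and the mean exit time (measured in variance) over the available variance. Each is at
  most (d + 1) / \<sigma>. For d + 1 > \<sigma> the claim exceeds 1.\<close>

lemma stay_le:
  assumes "\<bar>s\<bar> = 1" "set rs \<subseteq> {0..1}" "0 < \<sigma>" "\<sigma>\<^sup>2 \<le> walk_var rs" "0 \<le> d"
  shows "stay s rs d \<le> 2 * (d + 1) / \<sigma>"
proof (cases "d + 1 \<le> \<sigma>")
  case True
  define c where "c = 1 / walk_var rs"
  have V: "walk_var rs > 0" using assms by (smt (verit) zero_less_power2)
  have "stay s rs d \<le> (d + 1) / ((\<sigma> - 1) + 1) + c * ((d + 1) * ((\<sigma> - 1) + 1 - d)) + (1 - c * walk_var rs)"
    using assms True V by (intro stay_le_aux) (auto simp: c_def)
  also have "\<dots> = (d + 1) / \<sigma> + c * ((d + 1) * (\<sigma> - d))"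
    using V by (simp add: c_def)
  also have "c * ((d + 1) * (\<sigma> - d)) \<le> (1 / \<sigma>\<^sup>2) * ((d + 1) * \<sigma>)"
    using assms True V by (intro mult_mono) (auto simp: c_def intro!: divide_left_mono)
  also have "\<dots> = (d + 1) / \<sigma>" using assms by (simp add: power2_eq_square)
  finally show ?thesis by (simp add: add_divide_distrib)
next
  case False
  hence "1 \<le> 2 * (d + 1) / \<sigma>" using assms by (simp add: field_simps)
  thus ?thesis using stay_le_1[OF assms(2), of s d] by linarith
qed

text \<open>Kolmogorov's maximal inequality.\<close>

lemma stay_ge_quadratic:
  assumes "\<bar>s\<bar> = 1" "D > 0" "set rs \<subseteq> {0..1}"
  shows "stay s rs d \<ge> 1 - ((D - d)\<^sup>2 + walk_var rs) / D\<^sup>2"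
  using assms(3)
proof (induction rs arbitrary: d)
  case Nil
  show ?case
  proof (cases "d < 0")
    case True
    hence "D\<^sup>2 \<le> (D - d)\<^sup>2" using assms by (intro power_mono) auto
    thus ?thesis using True assms by (simp add: field_simps)
  qed (auto simp: walk_var_def)
next
  case (Cons r rs)
  have r: "0 \<le> r" "r \<le> 1" and rs: "set rs \<subseteq> {0..1}"
    using Cons.prems by auto
  have s2: "s * s = 1" using assms(1) by (metis abs_mult_self_eq mult_1)
  define F where "F = (\<lambda>d. 1 - ((D - d)\<^sup>2 + walk_var rs) / D\<^sup>2)"
  show ?case
  proof (cases "d < 0")
    case True
    hence "D\<^sup>2 \<le> (D - d)\<^sup>2" using assms by (intro power_mono) auto
    hence "D\<^sup>2 \<le> (D - d)\<^sup>2 + walk_var (r # rs)"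
      using walk_var_nonneg[OF Cons.prems] by linarith
    thus ?thesis using True assms by (simp add: field_simps)
  next
    case False
    have 1: "r * (D - (d - s * (1 - r)))\<^sup>2 + (1 - r) * (D - (d + s * r))\<^sup>2 = (D - d)\<^sup>2 + r * (1 - r)"
      using s2 by algebra
    have "r * F (d - s * (1 - r)) + (1 - r) * F (d + s * r) =
      1 - ((r * (D - (d - s * (1 - r)))\<^sup>2 + (1 - r) * (D - (d + s * r))\<^sup>2) + walk_var rs) / D\<^sup>2"
      unfolding F_def using assms(2) by (simp add: field_simps)
    also have "\<dots> = 1 - ((D - d)\<^sup>2 + walk_var (r # rs)) / D\<^sup>2"
      unfolding 1 by simp
    finally have "1 - ((D - d)\<^sup>2 + walk_var (r # rs)) / D\<^sup>2 = r * F (d - s * (1 - r)) + (1 - r) * F (d + s * r)" ..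
    also have "\<dots> \<le> r * stay s rs (d - s * (1 - r)) + (1 - r) * stay s rs (d + s * r)"
      unfolding F_def using r by (intro add_mono mult_left_mono Cons.IH[OF rs]) auto
    finally show ?thesis using False by simp
  qed
qed

text \<open>The linear martingale bounds the chance of reaching distance \<open>D\<close> first; from there the
  walk survives by the previous lemma.\<close>

lemma stay_ge:
  assumes "\<bar>s\<bar> = 1" "set rs \<subseteq> {0..1}" "0 < D" "4 * walk_var rs \<le> D\<^sup>2" "d \<le> D + 1"
  shows "stay s rs d \<ge> d / (2 * (D + 1))"
  using assms(2,4,5)
proof (induction rs arbitrary: d)
  case Nil
  thus ?case using assms by (auto simp: field_simps)
next
  case (Cons r rs)
  have r: "0 \<le> r" "r \<le> 1" and rs: "set rs \<subseteq> {0..1}"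
    using Cons.prems by auto
  consider "d < 0" | "0 \<le> d" "d < D" | "D \<le> d" by linarith
  thus ?case
  proof cases
    case 1
    thus ?thesis using assms by (auto simp: field_simps)
  next
    case 2
    have sr: "\<bar>s * r\<bar> \<le> 1" "\<bar>s * (1 - r)\<bar> \<le> 1"
      using assms(1) r by (auto simp: abs_mult)
    have v: "4 * walk_var rs \<le> D\<^sup>2"
      using Cons.prems r by (auto intro: order_trans[rotated])
    have "d / (2 * (D + 1)) = r * ((d - s * (1 - r)) / (2 * (D + 1))) + (1 - r) * ((d + s * r) / (2 * (D + 1)))"
      using assms(3) by (simp add: divide_simps) algebra
    also have "\<dots> \<le> r * stay s rs (d - s * (1 - r)) + (1 - r) * stay s rs (d + s * r)"
      using r sr 2 by (intro add_mono mult_left_mono Cons.IH[OF rs v]) auto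
    finally show ?thesis using 2 by simp
  next
    case 3
    \<comment> \<open>With the starting level d itself as reference level, the square vanishes and
      only the variance remains, which is at most a quarter of d squared.\<close>
    have "1 - ((d - d)\<^sup>2 + walk_var (r # rs)) / d\<^sup>2 \<le> stay s (r # rs) d"
      by (rule stay_ge_quadratic) (use assms(1,3) 3 Cons.prems in auto)
    moreover have "D\<^sup>2 \<le> d\<^sup>2" using 3 assms by (intro power_mono) auto
    hence "4 * walk_var (r # rs) \<le> d\<^sup>2" using Cons.prems by linarith
    hence "walk_var (r # rs) / d\<^sup>2 \<le> 1 / 4" using 3 assms by (simp add: field_simps del: walk_var_simps)
    moreover have "d / (2 * (D + 1)) \<le> 1 / 2" using Cons.prems assms by (simp add: field_simps)
    ultimately show ?thesis by (simp del: walk_var_simps)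
  qed
qed

section \<open>Random subsets and their walks\<close>

text \<open>The path that steps with s at the indices in U, compensated by its mean. Prefixes are
  half-open, and k = a is included: the empty prefix demands 0 \<le> d, just as \<open>stay\<close>
  tests the level before the first step.\<close>

definition below :: "real \<Rightarrow> (nat \<Rightarrow> real) \<Rightarrow> nat \<Rightarrow> nat \<Rightarrow> real \<Rightarrow> nat set \<Rightarrow> bool" where
  "below s r a b d U \<longleftrightarrow> (\<forall>k\<in>{a..b}. s * (real (card (U \<inter> {a..<k})) - (\<Sum>i\<in>{a..<k}. r i)) \<le> d)"

lemma below_step:
  assumes "a < b" "U \<subseteq> {Suc a..<b}"
  shows "below s r a b d U \<longleftrightarrow> 0 \<le> d \<and> below s r (Suc a) b (d + s * r a) U"
    and "below s r a b d (insert a U) \<longleftrightarrow> 0 \<le> d \<and> below s r (Suc a) b (d - s * (1 - r a)) U"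
proof -
  have iv: "{a..b} = insert a {Suc a..b}" using assms by auto
  have iv2: "{a..<k} = insert a {Suc a..<k}" if "k \<in> {Suc a..b}" for k using that by auto
  have "U \<inter> insert a {Suc a..<k} = U \<inter> {Suc a..<k}" for k using assms by auto
  thus "below s r a b d U \<longleftrightarrow> 0 \<le> d \<and> below s r (Suc a) b (d + s * r a) U"
    unfolding below_def iv ball_simps by (auto simp: iv2 algebra_simps)
  have "card (insert a U \<inter> insert a {Suc a..<k}) = Suc (card (U \<inter> {Suc a..<k}))" for k
  proof -
    have "insert a U \<inter> insert a {Suc a..<k} = insert a (U \<inter> {Suc a..<k})" using assms by auto
    thus ?thesis using assms by (simp add: card_insert_if)
  qed
  thus "below s r a b d (insert a U) \<longleftrightarrow> 0 \<le> d \<and> below s r (Suc a) b (d - s * (1 - r a)) U"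
    unfolding below_def iv ball_simps by (auto simp: iv2 algebra_simps)
qed

text \<open>The product is the law of a random set containing each i independently with probability
  \<open>r i\<close>. Splitting according to whether the smallest index a lies in U reproduces the
  recursion of \<open>stay\<close>.\<close>

lemma sum_below_eq_stay:
  assumes "a \<le> b"
  shows "(\<Sum>U | U \<subseteq> {a..<b} \<and> below s r a b d U. (\<Prod>i\<in>U. r i) * (\<Prod>i\<in>{a..<b} - U. 1 - r i)) =
    stay s (map r [a..<b]) d"
  using assms
proof (induction a arbitrary: d rule: inc_induct)
  case base
  have "{U. U \<subseteq> {b..<b} \<and> below s r b b d U} = (if d < 0 then {} else {{}})"
    by (auto simp: below_def)
  thus ?case by simp
next
  case (step a)
  let ?w = "\<lambda>a U. (\<Prod>i\<in>U. r i) * (\<Prod>i\<in>{a..<b} - U. 1 - r i)"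
  let ?S = "\<lambda>a d. {U. U \<subseteq> {a..<b} \<and> below s r a b d U}"
  have iv: "{a..<b} = insert a {Suc a..<b}" using step by auto
  show ?case
  proof (cases "d < 0")
    case True
    have "?S a d = {}" using True step by (auto simp: below_def intro!: bexI[of _ a])
    thus ?thesis using True by (simp only:) simp
  next
    case False
    have split: "?S a d = ?S (Suc a) (d + s * r a) \<union> insert a ` ?S (Suc a) (d - s * (1 - r a))"
    proof (intro equalityI subsetI)
      fix U assume U: "U \<in> ?S a d"
      show "U \<in> ?S (Suc a) (d + s * r a) \<union> insert a ` ?S (Suc a) (d - s * (1 - r a))"
      proof (cases "a \<in> U")
        case True
        then obtain V where V: "U = insert a V" "a \<notin> V" by (metis Set.set_insert)
        hence "V \<subseteq> {Suc a..<b}" using U iv by auto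
        thus ?thesis using U V below_step(2)[of a b V s r d] step by auto
      next
        case False
        hence "U \<subseteq> {Suc a..<b}" using U iv by auto
        thus ?thesis using U below_step(1)[of a b U s r d] step by auto
      qed
    next
      fix U assume "U \<in> ?S (Suc a) (d + s * r a) \<union> insert a ` ?S (Suc a) (d - s * (1 - r a))"
      thus "U \<in> ?S a d"
        using below_step[of a b _ s r d] step False by fastforce
    qed
    have fin: "finite (?S a d)" for a d
      by (rule finite_subset[of _ "Pow {a..<b}"]) auto
    have "(\<Sum>U\<in>?S a d. ?w a U) =
        (\<Sum>U\<in>?S (Suc a) (d + s * r a). ?w a U) + (\<Sum>U\<in>insert a ` ?S (Suc a) (d - s * (1 - r a)). ?w a U)"
      unfolding split by (rule sum.union_disjoint) (use fin in auto)
    also have "(\<Sum>U\<in>?S (Suc a) (d + s * r a). ?w a U) = (\<Sum>U\<in>?S (Suc a) (d + s * r a). (1 - r a) * ?w (Suc a) U)"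
    proof (rule sum.cong)
      fix U assume "U \<in> ?S (Suc a) (d + s * r a)"
      hence "{a..<b} - U = insert a ({Suc a..<b} - U)" using iv by auto
      thus "?w a U = (1 - r a) * ?w (Suc a) U" by simp
    qed auto
    also have "(\<Sum>U\<in>insert a ` ?S (Suc a) (d - s * (1 - r a)). ?w a U) =
        (\<Sum>U\<in>?S (Suc a) (d - s * (1 - r a)). ?w a (insert a U))"
      by (subst sum.reindex) (auto simp: inj_on_def o_def dest!: insert_ident[THEN iffD1, rotated -1])
    also have "\<dots> = (\<Sum>U\<in>?S (Suc a) (d - s * (1 - r a)). r a * ?w (Suc a) U)"
    proof (rule sum.cong)
      fix U assume U: "U \<in> ?S (Suc a) (d - s * (1 - r a))"
      hence "{a..<b} - insert a U = {Suc a..<b} - U" "finite U" "a \<notin> U" 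
        using iv finite_subset[of U "{Suc a..<b}"] by auto
      thus "?w a (insert a U) = r a * ?w (Suc a) U" by simp
    qed auto
    finally show ?thesis
      using step False by (simp add: upt_conv_Cons sum_distrib_left[symmetric])
  qed
qed

section \<open>Chebyshev and Mertens estimates\<close>

definition psi :: "nat \<Rightarrow> real" where
  "psi n = (\<Sum>d=1..n. mangoldt d)"

lemma psi_mono: "m \<le> n \<Longrightarrow> psi m \<le> psi n"
  unfolding psi_def by (intro sum_mono2) (auto simp: mangoldt_nonneg)

text \<open>Legendre's formula. Terms with d > n vanish, so any common range N is allowed; this lets
  the expansions for 2n and n be subtracted term by term.\<close>

lemma ln_fact_eq_sum_mangoldt:
  assumes "n \<le> N"
  shows "ln (fact n) = (\<Sum>d=1..N. mangoldt d * real (n div d))"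
  using assms
proof (induction n)
  case (Suc n)
  have "ln (fact (Suc n)) = ln (real (Suc n)) + ln (fact n)"
    unfolding fact_Suc by (subst ln_mult_pos) auto
  also have "ln (real (Suc n)) = (\<Sum>d | d dvd Suc n. mangoldt d)"
    using mangoldt_sum[of "Suc n", where ?'a = real] by simp
  also have "\<dots> = (\<Sum>d=1..N. if d dvd Suc n then mangoldt d else 0)"
  proof (rule sum.mono_neutral_cong_left)
    show "{d. d dvd Suc n} \<subseteq> {1..N}"
    proof
      fix d assume "d \<in> {d. d dvd Suc n}"
      hence "d dvd Suc n" by simp
      hence "d \<le> Suc n" "0 < d" by (auto intro: dvd_imp_le dvd_pos_nat[of "Suc n"])
      thus "d \<in> {1..N}" using Suc.prems by auto
    qed
  qed auto
  also have "ln (fact n) = (\<Sum>d=1..N. mangoldt d * real (n div d))" using Suc by simp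
  also have "(\<Sum>d=1..N. if d dvd Suc n then mangoldt d else 0) + \<dots> =
      (\<Sum>d=1..N. mangoldt d * real (Suc n div d))"
    unfolding sum.distrib[symmetric]
    by (intro sum.cong) (auto simp: div_Suc dvd_eq_mod_eq_0 algebra_simps)
  finally show ?case .
qed simp

lemma ln_central_binomial_eq:
  "ln (real ((2 * n) choose n)) = (\<Sum>d=1..2*n. mangoldt d * (real ((2 * n) div d) - 2 * real (n div d)))"
proof -
  have "real ((2 * n) choose n) = fact (2 * n) / (fact n * fact n)"
    using binomial_fact[of n "2 * n", where ?'a = real] by simp
  hence "ln (real ((2 * n) choose n)) = ln (fact (2 * n)) - 2 * ln (fact n :: real)"
    by (simp add: ln_div ln_mult)
  thus ?thesis
    using ln_fact_eq_sum_mangoldt[of "2 * n" "2 * n"] ln_fact_eq_sum_mangoldt[of n "2 * n"]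
    by (simp add: sum_distrib_left sum_subtractf algebra_simps)
qed

lemma double_div_bounds:
  fixes n d :: nat
  shows "2 * (n div d) \<le> (2 * n) div d" "(2 * n) div d \<le> 2 * (n div d) + 1"
proof -
  show "2 * (n div d) \<le> (2 * n) div d"
    by (cases "d = 0") (auto simp: less_eq_div_iff_mult_less_eq mult.assoc)
  show "(2 * n) div d \<le> 2 * (n div d) + 1"
  proof (cases "d = 0")
    case False
    have "n < d * (n div d) + d" using False dividend_less_times_div[of d n] by linarith
    hence "2 * n < (2 * (n div d) + 2) * d" by (simp add: algebra_simps)
    hence "(2 * n) div d < 2 * (n div d) + 2" by (rule less_mult_imp_div_less)
    thus ?thesis by simp
  qed simp
qed

text \<open>Chebyshev's argument: the coefficient of \<open>mangoldt d\<close> in the logarithm of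
  the central binomial is nonnegative, and it is at least 1 for n < d \<le> 2n.\<close>

lemma psi_double_diff_le: "psi (2 * n) - psi n \<le> ln (real ((2 * n) choose n))"
proof -
  have iv: "{1..2*n} = {1..n} \<union> {n<..2*n}" by auto
  have "psi (2 * n) = psi n + (\<Sum>d\<in>{n<..2*n}. mangoldt d)"
    unfolding psi_def iv by (rule sum.union_disjoint) auto
  hence "psi (2 * n) - psi n = (\<Sum>d\<in>{n<..2*n}. mangoldt d)" by simp
  also have "\<dots> \<le> (\<Sum>d\<in>{n<..2*n}. mangoldt d * (real ((2 * n) div d) - 2 * real (n div d)))"
  proof (rule sum_mono)
    fix d assume "d \<in> {n<..2*n}"
    hence "n div d = 0" "(2 * n) div d \<ge> 1" by (auto simp: Suc_le_eq div_greater_zero_iff)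
    hence "mangoldt d * 1 \<le> mangoldt d * (real ((2 * n) div d) - 2 * real (n div d))"
      by (intro mult_left_mono mangoldt_nonneg) auto
    thus "mangoldt d \<le> mangoldt d * (real ((2 * n) div d) - 2 * real (n div d))" by simp
  qed
  also have "\<dots> \<le> (\<Sum>d=1..2*n. mangoldt d * (real ((2 * n) div d) - 2 * real (n div d)))"
  proof (rule sum_mono2)
    fix d assume "d \<in> {1..2*n} - {n<..2*n}"
    show "0 \<le> mangoldt d * (real ((2 * n) div d) - 2 * real (n div d))"
      using double_div_bounds(1)[of n d] by (intro mult_nonneg_nonneg mangoldt_nonneg) linarith
  qed auto
  finally show ?thesis unfolding ln_central_binomial_eq .
qed

lemma ln_central_binomial_le_psi: "ln (real ((2 * n) choose n)) \<le> psi (2 * n)"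
  unfolding ln_central_binomial_eq psi_def
proof (rule sum_mono)
  fix d
  have "mangoldt d * (real ((2 * n) div d) - 2 * real (n div d)) \<le> mangoldt d * 1"
    using double_div_bounds(2)[of n d] by (intro mult_left_mono mangoldt_nonneg) linarith
  thus "mangoldt d * (real ((2 * n) div d) - 2 * real (n div d)) \<le> mangoldt d" by simp
qed

lemma ln_2_le_1: "ln (2 :: real) \<le> 1"
  using ln_le_minus_one[of 2] by simp

lemma psi_le: "psi n \<le> 4 * real n"
proof (induction n rule: less_induct)
  case (less n)
  have dbl: "psi (2 * m) \<le> psi m + 2 * real m" for m
  proof -
    have "real ((2 * m) choose m) \<le> 2 ^ (2 * m)"
      using binomial_le_pow2[of "2 * m" m] by (metis of_nat_le_iff of_nat_numeral of_nat_power)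
    hence "ln (real ((2 * m) choose m)) \<le> ln (2 ^ (2 * m))"
      by (subst ln_le_cancel_iff) auto
    also have "\<dots> \<le> 2 * real m"
      using mult_left_mono[OF ln_2_le_1, of "2 * real m"] by (simp add: ln_realpow)
    finally show ?thesis using psi_double_diff_le[of m] by linarith
  qed
  show ?case
  proof (cases "n \<le> 1")
    case True
    hence "psi n = 0" by (cases n) (auto simp: psi_def)
    thus ?thesis by simp
  next
    case False
    \<comment> \<open>Rounding up gives n \<le> 2m, while 3m \<le> 2n still holds for n \<ge> 2.
      Hence the induction closes with constant 4: 4m + 2m = 6m \<le> 4n.\<close>
    define m where "m = (n + 1) div 2"
    have m: "m < n" "n \<le> 2 * m" "3 * m \<le> 2 * n" using False unfolding m_def by presburger+
    have "psi n \<le> psi (2 * m)" by (rule psi_mono) fact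
    also have "\<dots> \<le> 4 * real m + 2 * real m" using dbl[of m] less.IH[OF m(1)] by linarith
    also have "\<dots> \<le> 4 * real n" using m(3) by linarith
    finally show ?thesis .
  qed
qed

lemma aprimedivisor_prime_nat:
  assumes "primepow (n :: nat)"
  shows "prime (aprimedivisor n)"
proof -
  obtain p k where "prime p" "k > 0" "n = p ^ k" using assms unfolding primepow_def by blast
  thus ?thesis using aprimedivisor_prime_power(1)[of p k] by (simp add: prime_imp_prime_elem)
qed

lemma primepow_nat_eq_power:
  assumes "primepow (n :: nat)"
  obtains k where "k > 0" "n = aprimedivisor n ^ k"
proof -
  obtain p k where "prime p" "k > 0" "n = p ^ k" using assms unfolding primepow_def by blast
  thus ?thesis using that[of k] aprimedivisor_prime_power(1)[of p k] by simp
qed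

text \<open>Each prime p has at most log n / log p powers up to n, each contributing ln p, so all
  powers of p together contribute at most ln n.\<close>

lemma psi_le_card_primes: "psi n \<le> real (card {p. prime p \<and> p \<le> n}) * ln (real n)"
proof (cases "n = 0")
  case False
  define S where "S = {d\<in>{1..n}. primepow d}"
  define P where "P = {p. prime p \<and> p \<le> n}"
  have fin: "finite S" "finite P" unfolding S_def P_def by auto
  have ap: "aprimedivisor ` S \<subseteq> P"
  proof
    fix p assume "p \<in> aprimedivisor ` S"
    then obtain d where d: "d \<in> S" "p = aprimedivisor d" by auto
    have "d > 1" using d primepow_gt_Suc_0[of d] by (auto simp: S_def)
    thus "p \<in> P" using d aprimedivisor_prime_nat[of d] aprimedivisor_le_nat[of d]
      by (auto simp: S_def P_def)
  qed
  have "psi n = (\<Sum>d\<in>S. mangoldt d)"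
    unfolding psi_def S_def by (intro sum.mono_neutral_right) (auto simp: mangoldt_def)
  also have "\<dots> = (\<Sum>p\<in>P. \<Sum>d\<in>{d\<in>S. aprimedivisor d = p}. mangoldt d)"
    by (rule sum.group[symmetric]) (use fin ap in auto)
  also have "\<dots> \<le> (\<Sum>p\<in>P. ln (real n))"
  proof (rule sum_mono)
    fix p assume p: "p \<in> P"
    hence p1: "real p > 1" using prime_gt_1_nat[of p] by (auto simp: P_def)
    define M where "M = nat \<lfloor>log (real p) (real n)\<rfloor>"
    have "{d\<in>S. aprimedivisor d = p} \<subseteq> (\<lambda>k. p ^ k) ` {1..M}"
    proof
      fix d assume d: "d \<in> {d\<in>S. aprimedivisor d = p}"
      then obtain k where k: "k > 0" "d = p ^ k" by (auto simp: S_def elim: primepow_nat_eq_power)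
      have "real p ^ k \<le> real n" using d k by (auto simp: S_def simp flip: of_nat_power)
      hence "real k \<le> log (real p) (real n)"
        using p1 False by (simp add: le_log_iff powr_realpow)
      hence "k \<le> M" unfolding M_def by linarith
      thus "d \<in> (\<lambda>k. p ^ k) ` {1..M}" using k by auto
    qed
    hence "card {d\<in>S. aprimedivisor d = p} \<le> card ((\<lambda>k. p ^ k) ` {1..M})"
      by (intro card_mono) auto
    also have "\<dots> \<le> M" using card_image_le[of "{1..M}" "\<lambda>k. p ^ k"] by simp
    finally have "card {d\<in>S. aprimedivisor d = p} \<le> M" .
    moreover have "real M \<le> log (real p) (real n)"
      unfolding M_def using p1 False by (simp add: zero_le_log_cancel_iff)
    ultimately have "real (card {d\<in>S. aprimedivisor d = p}) * ln (real p) \<le> log (real p) (real n) * ln (real p)"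
      using p1 by (intro mult_right_mono) auto
    also have "\<dots> = ln (real n)" using p1 by (simp add: log_def)
    finally show "(\<Sum>d\<in>{d\<in>S. aprimedivisor d = p}. mangoldt d) \<le> ln (real n)"
      by (simp add: S_def mangoldt_def)
  qed
  finally show ?thesis by (simp add: P_def)
qed (auto simp: psi_def)

text \<open>Take n = floor (z / 2). The central binomial is at least 4^n / (2n) and its logarithm is
  at most \<open>psi (2 * n)\<close>. The crude ln 2 \<ge> 1/2 already gives n - ln (2n), which
  exceeds z/4 eventually.\<close>

lemma card_primes_lower_bound:
  "\<exists>z0. \<forall>z\<ge>z0. z / (4 * ln z) \<le> real (card {p. prime p \<and> real p \<le> z})"
proof -
  have "eventually (\<lambda>z::real. z / 4 \<le> (z / 2 - 1) - ln z \<and> z \<ge> 4) at_top" by (intro eventually_conj; real_asymp)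
  then obtain z0 :: real where z0: "\<And>z. z \<ge> z0 \<Longrightarrow> z / 4 \<le> (z / 2 - 1) - ln z \<and> z \<ge> 4"
    by (auto simp: eventually_at_top_linorder)
  have "z / (4 * ln z) \<le> real (card {p. prime p \<and> real p \<le> z})" if z: "z \<ge> z0" for z
  proof -
    define n where "n = nat \<lfloor>z / 2\<rfloor>"
    have z4: "z \<ge> 4" using z0[OF z] by simp
    have n: "n > 0" "real n \<le> z / 2" "real n \<ge> z / 2 - 1" using z4 unfolding n_def by linarith+
    have l2: "ln 2 \<ge> (1/2 :: real)"
      using ln_le_minus_one[of "1 / 2 :: real"] by (simp add: ln_div)
    have "real n \<le> ln (4 ^ n)" using l2 ln_mult[of 2 "2::real"] n by (simp add: ln_realpow field_simps)
    hence "z / 2 - 1 - ln z \<le> ln (4 ^ n) - ln (2 * real n)"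
      using n z4 ln_le_cancel_iff[of "2 * real n" z] by linarith
    also have "\<dots> = ln (4 ^ n / (2 * real n))" using n by (simp add: ln_div)
    also have "\<dots> \<le> ln (real ((2 * n) choose n))"
      using central_binomial_lower_bound[of n] n by (subst ln_le_cancel_iff) auto
    also have "\<dots> \<le> psi (2 * n)" by (rule ln_central_binomial_le_psi)
    also have "\<dots> \<le> real (card {p. prime p \<and> p \<le> 2 * n}) * ln (real (2 * n))" by (rule psi_le_card_primes)
    also have "\<dots> \<le> real (card {p. prime p \<and> real p \<le> z}) * ln z"
    proof (intro mult_mono of_nat_mono card_mono)
      have "{p. prime p \<and> real p \<le> z} \<subseteq> {..nat \<lfloor>z\<rfloor>}" by (auto simp: le_nat_floor)
      thus "finite {p. prime p \<and> real p \<le> z}" by (rule finite_subset) auto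
      show "ln (real (2 * n)) \<le> ln z" using n z4 by (subst ln_le_cancel_iff) auto
    qed (use n z4 in auto)
    finally have "z / 4 \<le> real (card {p. prime p \<and> real p \<le> z}) * ln z" using z0[OF z] by linarith
    moreover have "ln z > 0" using z4 by simp
    ultimately show ?thesis by (simp add: field_simps)
  qed
  thus ?thesis by blast
qed

lemma ln_fact_bounds:
  assumes "n \<ge> 1"
  shows "ln (fact n) \<le> real n * ln (real n)" "ln (fact n) \<ge> real n * ln (real n) - real n"
proof -
  have "ln (fact n :: real) \<le> ln (real n ^ n)"
    using fact_le_power[of n, where ?'a = real] assms by (subst ln_le_cancel_iff) auto
  also have "\<dots> = real n * ln (real n)" using assms by (intro ln_realpow)
  finally show "ln (fact n) \<le> real n * ln (real n)" .
  show "ln (fact n) \<ge> real n * ln (real n) - real n" using assms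
  proof (induction n rule: dec_induct)
    case (step n)
    have "real n * (ln (real (Suc n)) - ln (real n)) \<le> real n * (1 / real n)"
      using step ln_diff_le[of "real (Suc n)" "real n"] by (intro mult_left_mono) auto
    moreover have "ln (fact (Suc n) :: real) = ln (real (Suc n)) + ln (fact n)"
      unfolding fact_Suc by (subst ln_mult_pos) auto
    ultimately show ?case using step by (simp add: algebra_simps del: fact_Suc)
  qed simp
qed

text \<open>Replace the floor n div d by n / d in Legendre's formula. The total error is at most
  \<open>psi n\<close> \<le> 4n, and the factorial is known up to an error n.\<close>

lemma sum_mangoldt_div_bounds:
  assumes "n \<ge> 1"
  shows "(\<Sum>d=1..n. mangoldt d / real d) \<le> ln (real n) + 4"
    and "(\<Sum>d=1..n. mangoldt d / real d) \<ge> ln (real n) - 1"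
proof -
  define S :: real where "S = (\<Sum>d=1..n. mangoldt d / real d)"
  have n: "real n > 0" using assms by simp
  have eq: "ln (fact n) = (\<Sum>d=1..n. mangoldt d * real (n div d))"
    by (rule ln_fact_eq_sum_mangoldt) simp
  have bds: "real n / real d - 1 \<le> real (n div d)" "real (n div d) \<le> real n / real d" for d
  proof -
    show "real n / real d - 1 \<le> real (n div d)"
      using floor_divide_of_nat_eq[of n d, where ?'a = real] by linarith
    show "real (n div d) \<le> real n / real d" by (rule of_nat_div_le_of_nat)
  qed
  have "real n * S - psi n = (\<Sum>d=1..n. mangoldt d * (real n / real d - 1))"
    unfolding S_def psi_def by (simp add: sum_distrib_left sum_subtractf algebra_simps)
  also have "\<dots> \<le> ln (fact n)" unfolding eq
    by (intro sum_mono mult_left_mono mangoldt_nonneg bds)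
  also have "\<dots> \<le> real n * ln (real n)" by (rule ln_fact_bounds) fact
  finally have "real n * S \<le> real n * (ln (real n) + 4)" using psi_le[of n] by (simp add: algebra_simps)
  thus "(\<Sum>d=1..n. mangoldt d / real d) \<le> ln (real n) + 4" using n by (simp add: S_def)
  have "ln (fact n) \<le> (\<Sum>d=1..n. mangoldt d * (real n / real d))" unfolding eq
    by (intro sum_mono mult_left_mono mangoldt_nonneg bds)
  also have "\<dots> = real n * S" unfolding S_def by (simp add: sum_distrib_left algebra_simps)
  finally have "real n * (ln (real n) - 1) \<le> real n * S"
    using ln_fact_bounds(2)[OF assms] by (simp add: algebra_simps)
  thus "(\<Sum>d=1..n. mangoldt d / real d) \<ge> ln (real n) - 1" using n by (simp add: S_def)
qed

section \<open>Mertens' theorems and Euler products\<close>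

lemma summable_ln_over_square: "summable (\<lambda>n. ln (real n) / (real n * (real n - 1)))"
proof (rule summable_comparison_test_bigo)
  show "summable (\<lambda>n. norm (real n powr (-3/2)))" by (simp add: summable_real_powr_iff)
  show "(\<lambda>n. ln (real n) / (real n * (real n - 1))) \<in> O(\<lambda>n. real n powr (-3/2))"
    by real_asymp
qed

text \<open>The von Mangoldt sum differs from the prime sum by the powers p^k with k \<ge> 2. A
  geometric series bounds their share for a given p by ln p / (p (p - 1)), which is summable even
  over all integers.\<close>

lemma mertens_first:
  "\<exists>C\<ge>0. \<forall>n\<ge>1. \<bar>(\<Sum>p | prime p \<and> p \<le> n. ln (real p) / real p) - ln (real n)\<bar> \<le> C"
proof -
  define K where "K = (\<Sum>n. ln (real n) / (real n * (real n - 1)))"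
  have term_nonneg: "0 \<le> ln (real n) / (real n * (real n - 1))" for n :: nat
    by (cases "n = 0") auto
  have K0: "K \<ge> 0" unfolding K_def by (intro suminf_nonneg summable_ln_over_square term_nonneg)
  have main: "\<bar>(\<Sum>p | prime p \<and> p \<le> n. ln (real p) / real p) - ln (real n)\<bar> \<le> K + 4" if n: "n \<ge> 1" for n :: nat
  proof -
    define P where "P = {p. prime p \<and> p \<le> n}"
    define S where "S = {d\<in>{1..n}. primepow d \<and> \<not> prime d}"
    have fin: "finite P" "finite S" unfolding P_def S_def by auto
    have "(\<Sum>d=1..n. mangoldt d / real d) = (\<Sum>d\<in>P \<union> S. mangoldt d / real d :: real)"
      by (rule sum.mono_neutral_right)
         (auto simp: P_def S_def mangoldt_def prime_ge_1_nat dest: prime_gt_0_nat)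
    also have "\<dots> = (\<Sum>d\<in>P. mangoldt d / real d) + (\<Sum>d\<in>S. mangoldt d / real d)"
      by (rule sum.union_disjoint) (use fin in \<open>auto simp: P_def S_def\<close>)
    also have "(\<Sum>d\<in>P. mangoldt d / real d) = (\<Sum>p\<in>P. ln (real p) / real p :: real)"
      by (intro sum.cong) (auto simp: P_def)
    finally have eq: "(\<Sum>p\<in>P. ln (real p) / real p) =
        (\<Sum>d=1..n. mangoldt d / real d) - (\<Sum>d\<in>S. mangoldt d / real d)" by simp
    have S0: "0 \<le> (\<Sum>d\<in>S. mangoldt d / real d :: real)"
      by (intro sum_nonneg divide_nonneg_nonneg mangoldt_nonneg) auto
    have ap: "aprimedivisor ` S \<subseteq> P"
    proof
      fix p assume "p \<in> aprimedivisor ` S"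
      then obtain d where d: "d \<in> S" "p = aprimedivisor d" by auto
      have "d > 1" using d primepow_gt_Suc_0[of d] by (auto simp: S_def)
      thus "p \<in> P" using d aprimedivisor_prime_nat[of d] aprimedivisor_le_nat[of d]
        by (auto simp: S_def P_def)
    qed
    have "(\<Sum>d\<in>S. mangoldt d / real d :: real) = (\<Sum>p\<in>P. \<Sum>d\<in>{d\<in>S. aprimedivisor d = p}. mangoldt d / real d)"
      by (rule sum.group[symmetric]) (use fin ap in auto)
    also have "\<dots> \<le> (\<Sum>p\<in>P. ln (real p) / (real p * (real p - 1)))"
    proof (rule sum_mono)
      fix p assume p: "p \<in> P"
      hence p1: "real p > 1" using prime_gt_1_nat[of p] by (auto simp: P_def)
      have sub: "{d\<in>S. aprimedivisor d = p} \<subseteq> (\<lambda>k. p ^ (k + 2)) ` {..<n}"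
      proof
        fix d assume d: "d \<in> {d\<in>S. aprimedivisor d = p}"
        then obtain k where k: "k > 0" "d = p ^ k" by (auto simp: S_def elim: primepow_nat_eq_power)
        moreover have "k \<noteq> 1" using d k p by (auto simp: S_def P_def)
        moreover from calculation have "(k - 2) + 2 = k" by linarith
        hence "d = p ^ ((k - 2) + 2)" using k by simp
        moreover have "k < p ^ k" using p1 by (intro power_gt_expt) auto
        hence "k < n" using d k by (auto simp: S_def)
        ultimately show "d \<in> (\<lambda>k. p ^ (k + 2)) ` {..<n}" by (intro image_eqI[of _ _ "k - 2"]) (blast, simp)
      qed
      have inj: "inj_on (\<lambda>k. p ^ (k + 2)) {..<n}"
        using p1 by (intro inj_onI) (simp add: power_inject_exp)
      have "(\<Sum>d\<in>{d\<in>S. aprimedivisor d = p}. mangoldt d / real d) \<le> (\<Sum>d\<in>(\<lambda>k. p ^ (k + 2)) ` {..<n}. mangoldt d / real d :: real)"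
        by (intro sum_mono2 sub divide_nonneg_nonneg mangoldt_nonneg) auto
      also have "\<dots> = (\<Sum>k<n. ln (real p) / (real p)\<^sup>2 * (1 / real p) ^ k)"
      proof (subst sum.reindex[OF inj], rule sum.cong)
        fix k
        have "mangoldt (p ^ (k + 2)) = ln (real p)"
          using mangoldt_primepow'[of p "k + 2", where ?'a = real] p by (simp add: P_def)
        thus "((\<lambda>d. mangoldt d / real d) \<circ> (\<lambda>k. p ^ (k + 2))) k = ln (real p) / (real p)\<^sup>2 * (1 / real p) ^ k"
          by (simp add: power_one_over power_add power2_eq_square)
      qed auto
      also have "\<dots> = ln (real p) / (real p)\<^sup>2 * (\<Sum>k<n. (1 / real p) ^ k)" by (simp add: sum_distrib_left)
      also have "\<dots> \<le> ln (real p) / (real p)\<^sup>2 * (1 / (1 - 1 / real p))"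
      proof (rule mult_left_mono)
        have "(\<Sum>k<n. (1 / real p) ^ k) \<le> (\<Sum>k. (1 / real p) ^ k)"
          using p1 by (intro sum_le_suminf summable_geometric) auto
        also have "\<dots> = 1 / (1 - 1 / real p)"
          using p1 by (intro suminf_geometric) auto
        finally show "(\<Sum>k<n. (1 / real p) ^ k) \<le> 1 / (1 - 1 / real p)" .
      qed (use p1 in auto)
      also have "\<dots> = ln (real p) / (real p * (real p - 1))"
        using p1 by (simp add: field_simps power2_eq_square)
      finally show "(\<Sum>d\<in>{d\<in>S. aprimedivisor d = p}. mangoldt d / real d) \<le> ln (real p) / (real p * (real p - 1))" .
    qed
    also have "\<dots> \<le> K" unfolding K_def
      by (intro sum_le_suminf summable_ln_over_square term_nonneg) (use fin in auto)
    finally show ?thesis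
      using eq S0 sum_mangoldt_div_bounds[OF n] unfolding P_def by linarith
  qed
  show ?thesis by (rule exI[of _ "K + 4"]) (use main K0 in auto)
qed

text \<open>A discrete substitute for integrating 1 / (t ln t) in partial summation: the error 1 /
  ln n - 1 / ln (n + 1) telescopes.\<close>

lemma lnln_diff_bounds:
  assumes "n \<ge> 2"
  defines "\<Delta> \<equiv> ln (real (Suc n)) - ln (real n)"
  shows "\<Delta> / ln (real (Suc n)) \<le> ln (ln (real (Suc n))) - ln (ln (real n))"
    and "ln (ln (real (Suc n))) - ln (ln (real n)) \<le> \<Delta> / ln (real (Suc n)) + (1 / ln (real n) - 1 / ln (real (Suc n)))"
proof -
  have pos: "ln (real n) > 0" "ln (real (Suc n)) > 0" using assms by auto
  have mono: "ln (real n) \<le> ln (real (Suc n))" using assms by (subst ln_le_cancel_iff) auto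
  have "\<Delta> \<le> (real (Suc n) - real n) / real n"
    unfolding \<Delta>_def using assms by (intro ln_diff_le) auto
  also have "\<dots> \<le> 1" using assms by simp
  finally have \<Delta>: "\<Delta> \<le> 1" .
  have "ln (ln (real n)) - ln (ln (real (Suc n))) \<le> (ln (real n) - ln (real (Suc n))) / ln (real (Suc n))"
    by (rule ln_diff_le) fact+
  thus "\<Delta> / ln (real (Suc n)) \<le> ln (ln (real (Suc n))) - ln (ln (real n))"
    unfolding \<Delta>_def by (simp add: diff_divide_distrib)
  have "ln (ln (real (Suc n))) - ln (ln (real n)) \<le> \<Delta> / ln (real n)"
    unfolding \<Delta>_def by (rule ln_diff_le) fact+
  also have "\<dots> = \<Delta> / ln (real (Suc n)) + \<Delta> * (1 / ln (real n) - 1 / ln (real (Suc n)))"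
    by (simp add: right_diff_distrib)
  also have "\<Delta> * (1 / ln (real n) - 1 / ln (real (Suc n))) \<le> 1 * (1 / ln (real n) - 1 / ln (real (Suc n)))"
    using \<Delta> mono pos by (intro mult_right_mono) (auto simp: field_simps)
  finally show "ln (ln (real (Suc n))) - ln (ln (real n)) \<le> \<Delta> / ln (real (Suc n)) + (1 / ln (real n) - 1 / ln (real (Suc n)))"
    by simp
qed

lemma sum_primes_Suc:
  fixes f :: "nat \<Rightarrow> 'a :: comm_monoid_add"
  shows "(\<Sum>p | prime p \<and> p \<le> Suc n. f p) = (if prime (Suc n) then f (Suc n) else 0) + (\<Sum>p | prime p \<and> p \<le> n. f p)"
proof (cases "prime (Suc n)")
  case True
  hence "{p. prime p \<and> p \<le> Suc n} = insert (Suc n) {p. prime p \<and> p \<le> n}" by (auto simp: le_Suc_eq)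
  thus ?thesis using True by simp
next
  case False
  hence "{p. prime p \<and> p \<le> Suc n} = {p. prime p \<and> p \<le> n}" by (auto simp: le_Suc_eq)
  thus ?thesis using False by simp
qed

text \<open>Partial summation from \<open>mertens_first\<close>, done as an induction. D is what
  remains of the error after the boundary term \<open>R n * f n\<close> is taken off; its increments
  involve only the bounded R times \<open>f n - f (Suc n)\<close>, and the error of
  \<open>lnln_diff_bounds\<close>.\<close>

lemma mertens_second:
  "\<exists>C\<ge>0. \<forall>n\<ge>2. \<bar>(\<Sum>p | prime p \<and> p \<le> n. 1 / real p) - ln (ln (real n))\<bar> \<le> C"
proof -
  obtain C where C: "C \<ge> 0" and mert:
      "\<And>n. n \<ge> 1 \<Longrightarrow> \<bar>(\<Sum>p | prime p \<and> p \<le> n. ln (real p) / real p) - ln (real n)\<bar> \<le> C"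
    using mertens_first by blast
  define B where "B = (\<lambda>n. \<Sum>p | prime p \<and> p \<le> n. 1 / real p)"
  define R where "R = (\<lambda>n. (\<Sum>p | prime p \<and> p \<le> n. ln (real p) / real p) - ln (real n))"
  define f where "f = (\<lambda>n. 1 / ln (real n))"
  define D where "D = (\<lambda>n. B n - ln (ln (real n)) - R n * f n)"
  define K where "K = \<bar>D 2\<bar> + (C + 1) * f 2"
  have f: "0 \<le> f n" if "n \<ge> 2" for n using that by (auto simp: f_def)
  \<comment> \<open>The subtracted multiple of \<open>f n\<close> makes the induction work: it
    decreases by exactly the allowed increment of D. K is chosen to fit n = 2.\<close>
  have D: "\<bar>D n\<bar> \<le> K - (C + 1) * f n" if "n \<ge> 2" for n
    using that
  proof (induction n rule: dec_induct)
    case base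
    thus ?case by (simp add: K_def)
  next
    case (step n)
    define \<Delta> where "\<Delta> = ln (real (Suc n)) - ln (real n)"
    define a where "a = (if prime (Suc n) then 1 / real (Suc n) else 0)"
    have mono: "f (Suc n) \<le> f n"
      unfolding f_def using step by (intro divide_left_mono) auto
    have B: "B (Suc n) = a + B n" unfolding B_def a_def by (rule sum_primes_Suc)
    have ln0: "ln (real (Suc n)) \<noteq> 0" using step by auto
    have R: "R (Suc n) = a * ln (real (Suc n)) + R n - \<Delta>"
      unfolding R_def sum_primes_Suc \<Delta>_def a_def by simp
    have "R (Suc n) * f (Suc n) = a * (ln (real (Suc n)) * f (Suc n)) + R n * f (Suc n) - \<Delta> * f (Suc n)"
      unfolding R by (simp add: algebra_simps)
    moreover have "ln (real (Suc n)) * f (Suc n) = 1" using ln0 by (simp add: f_def)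
    ultimately have "R (Suc n) * f (Suc n) = a + R n * f (Suc n) - \<Delta> * f (Suc n)" by simp
    hence "D (Suc n) - D n = R n * (f n - f (Suc n)) + (\<Delta> * f (Suc n) - (ln (ln (real (Suc n))) - ln (ln (real n))))"
      unfolding D_def B by (simp add: algebra_simps)
    also have "\<bar>\<dots>\<bar> \<le> C * (f n - f (Suc n)) + (f n - f (Suc n))"
    proof (rule order_trans[OF abs_triangle_ineq add_mono])
      show "\<bar>R n * (f n - f (Suc n))\<bar> \<le> C * (f n - f (Suc n))"
        using mert[of n] mono step unfolding abs_mult R_def by (intro mult_mono) auto
      show "\<bar>\<Delta> * f (Suc n) - (ln (ln (real (Suc n))) - ln (ln (real n)))\<bar> \<le> f n - f (Suc n)"
        using lnln_diff_bounds[OF step(1)] unfolding f_def \<Delta>_def by simp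
    qed
    also have "\<dots> = (C + 1) * (f n - f (Suc n))" by (simp add: distrib_right)
    finally have "\<bar>D (Suc n) - D n\<bar> \<le> (C + 1) * (f n - f (Suc n))" .
    hence "\<bar>D (Suc n)\<bar> \<le> \<bar>D n\<bar> + (C + 1) * (f n - f (Suc n))" by linarith
    thus ?case using step.IH by (simp add: algebra_simps)
  qed
  have "\<bar>B n - ln (ln (real n))\<bar> \<le> K + C * f 2" if n: "n \<ge> 2" for n
  proof -
    have "f n \<le> f 2" unfolding f_def using n by (intro divide_left_mono) auto
    hence "\<bar>R n * f n\<bar> \<le> C * f 2"
      using mert[of n] f[OF n] n C unfolding abs_mult R_def by (intro mult_mono) auto
    moreover have "\<bar>D n\<bar> \<le> K" using D[OF n] f[OF n] C by (smt (verit) mult_nonneg_nonneg)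
    ultimately show ?thesis unfolding D_def by linarith
  qed
  moreover have "K + C * f 2 \<ge> 0" using C f[of 2] by (simp add: K_def)
  ultimately show ?thesis unfolding B_def by blast
qed

text \<open>The exchange rate between 1 / (p - 1), 1 / p and 1 / (p + 1): replacing one by its
  neighbour costs at most 1 / (p (p - 1)) per prime, hence at most 1 in total.\<close>

lemma sum_telescope_inverse_le_1:
  assumes "finite A" "A \<subseteq> {2..}"
  shows "(\<Sum>n\<in>A. 1 / (real n * (real n - 1))) \<le> 1"
proof -
  have tel: "(\<Sum>n=2..Suc N. 1 / (real n * (real n - 1))) = 1 - 1 / real (Suc N)" for N
  proof (induction N)
    case (Suc N)
    have "1 / (real (Suc (Suc N)) * (real (Suc (Suc N)) - 1)) = 1 / real (Suc N) - 1 / real (Suc (Suc N))"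
      by (simp add: divide_simps)
    thus ?case using Suc by simp
  qed simp
  obtain N where N: "A \<subseteq> {..N}" using assms(1) by (auto simp: finite_nat_set_iff_bounded_le)
  have "A \<subseteq> {2..Suc N}"
    using N assms(2) by (auto simp: subset_iff le_Suc_eq)
  hence "(\<Sum>n\<in>A. 1 / (real n * (real n - 1))) \<le> (\<Sum>n=2..Suc N. 1 / (real n * (real n - 1)))"
    by (intro sum_mono2) auto
  also have "\<dots> \<le> 1" unfolding tel by simp
  finally show ?thesis .
qed

text \<open>The factor 1 + 1 / (p - 1) is the full Euler factor 1 / (1 - 1 / p), so this bounds the
  sum of 1/m over all integers m composed of primes up to n.\<close>

lemma prod_primes_upper:
  "\<exists>C>0. \<forall>n\<ge>2. (\<Prod>p | prime p \<and> p \<le> n. 1 + 1 / (real p - 1)) \<le> C * ln (real n)"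
proof -
  obtain C where C: "\<And>n. n \<ge> 2 \<Longrightarrow> \<bar>(\<Sum>p | prime p \<and> p \<le> n. 1 / real p) - ln (ln (real n))\<bar> \<le> C"
    using mertens_second by blast
  have "(\<Prod>p | prime p \<and> p \<le> n. 1 + 1 / (real p - 1)) \<le> exp (C + 1) * ln (real n)" if n: "n \<ge> 2" for n
  proof -
    define Q where "Q = {p. prime p \<and> p \<le> n}"
    have Q: "finite Q" "Q \<subseteq> {2..}" unfolding Q_def by (auto dest: prime_ge_2_nat)
    have p1: "real p \<ge> 2" if "p \<in> Q" for p using Q that by force
    have "(\<Prod>p\<in>Q. 1 + 1 / (real p - 1)) \<le> (\<Prod>p\<in>Q. exp (1 / (real p - 1)))"
      using p1 by (intro prod_mono) (auto simp: add_nonneg_nonneg exp_ge_add_one_self dest!: p1)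
    also have "\<dots> = exp (\<Sum>p\<in>Q. 1 / (real p - 1))" using Q by (simp add: exp_sum)
    also have "(\<Sum>p\<in>Q. 1 / (real p - 1)) = (\<Sum>p\<in>Q. 1 / real p) + (\<Sum>p\<in>Q. 1 / (real p * (real p - 1)))"
      unfolding sum.distrib[symmetric] by (intro sum.cong) (auto simp: divide_simps dest!: p1)
    also have "\<dots> \<le> ln (ln (real n)) + C + 1"
      using C[OF n] sum_telescope_inverse_le_1[OF Q] unfolding Q_def by linarith
    also have "exp \<dots> = exp (C + 1) * ln (real n)" using n by (simp add: exp_add)
    finally show ?thesis by (simp add: Q_def)
  qed
  thus ?thesis by (intro exI[of _ "exp (C + 1)"]) auto
qed

lemma sum_primes_interval:
  fixes f :: "nat \<Rightarrow> 'a :: ab_group_add"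
  assumes "T \<le> n"
  shows "(\<Sum>p | prime p \<and> T < p \<and> p \<le> n. f p) = (\<Sum>p | prime p \<and> p \<le> n. f p) - (\<Sum>p | prime p \<and> p \<le> T. f p)"
proof -
  have "{p. prime p \<and> p \<le> n} = {p. prime p \<and> p \<le> T} \<union> {p. prime p \<and> T < p \<and> p \<le> n}"
    using assms by auto
  also have "sum f \<dots> = (\<Sum>p | prime p \<and> p \<le> T. f p) + (\<Sum>p | prime p \<and> T < p \<and> p \<le> n. f p)"
    by (rule sum.union_disjoint) auto
  finally show ?thesis by simp
qed

text \<open>The squarefree counterpart: the mass of squarefree products of primes in (T, n]. The
  loss in ln (1 + u) \<ge> u - u^2 is summable.\<close>

lemma prod_primes_lower:
  assumes "T \<ge> 2"
  shows "\<exists>c>0. \<forall>n\<ge>T. c * ln (real n) \<le> (\<Prod>p | prime p \<and> T < p \<and> p \<le> n. 1 + 1 / real p)"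
proof -
  obtain C where C: "\<And>n. n \<ge> 2 \<Longrightarrow> \<bar>(\<Sum>p | prime p \<and> p \<le> n. 1 / real p) - ln (ln (real n))\<bar> \<le> C"
    using mertens_second by blast
  define c where "c = exp (- C - ln (ln (real T)) - C - 1)"
  have "c * ln (real n) \<le> (\<Prod>p | prime p \<and> T < p \<and> p \<le> n. 1 + 1 / real p)" if n: "n \<ge> T" for n
  proof -
    define Q where "Q = {p. prime p \<and> T < p \<and> p \<le> n}"
    have Q: "finite Q" "Q \<subseteq> {2..}" unfolding Q_def by (auto dest: prime_ge_2_nat)
    have p2: "real p \<ge> 2" if "p \<in> Q" for p using Q that by force
    have "c * ln (real n) = exp (ln (ln (real n)) - C - ln (ln (real T)) - C - 1)"
      unfolding c_def using n assms by (simp add: exp_add exp_diff exp_minus field_simps)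
    also have "ln (ln (real n)) - C - ln (ln (real T)) - C - 1 \<le>
        (\<Sum>p\<in>Q. 1 / real p) - (\<Sum>p\<in>Q. 1 / (real p * (real p - 1)))"
      using C[of n] C[of T] n assms sum_telescope_inverse_le_1[OF Q] sum_primes_interval[OF n, of "\<lambda>p. 1 / real p"]
      unfolding Q_def by linarith
    also have "\<dots> = (\<Sum>p\<in>Q. 1 / real p - 1 / (real p * (real p - 1)))"
      by (simp add: sum_subtractf)
    also have "\<dots> \<le> (\<Sum>p\<in>Q. ln (1 + 1 / real p))"
    proof (rule sum_mono)
      fix p assume "p \<in> Q"
      hence p: "real p \<ge> 2" by (rule p2)
      have "1 / real p - 1 / (real p * (real p - 1)) \<le> 1 / real p - (1 / real p)\<^sup>2"
        using p by (simp add: power2_eq_square frac_le)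
      also have "\<dots> \<le> ln (1 + 1 / real p)" using p by (intro ln_one_plus_pos_lower_bound) auto
      finally show "1 / real p - 1 / (real p * (real p - 1)) \<le> ln (1 + 1 / real p)" .
    qed
    also have "exp (\<Sum>p\<in>Q. ln (1 + 1 / real p)) = (\<Prod>p\<in>Q. 1 + 1 / real p)"
      using Q p2 by (subst exp_sum) (auto intro!: prod.cong exp_ln add_pos_nonneg)
    finally show ?thesis by (simp add: Q_def)
  qed
  thus ?thesis by (intro exI[of _ c]) (auto simp: c_def)
qed

section \<open>Sums over integers with prescribed prime factors\<close>

text \<open>An integer with prime support U is a vector of exponents \<ge> 1, so the sum is bounded
  by a product over U of geometric series, each of value 1 / (p - 1).\<close>

lemma sum_inverse_same_support_le:
  assumes "finite M" "finite U" "\<And>p. p \<in> U \<Longrightarrow> prime p" "\<And>m. m \<in> M \<Longrightarrow> 0 < m \<and> prime_factors m = U"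
  shows "(\<Sum>m\<in>M. 1 / real m) \<le> (\<Prod>p\<in>U. 1 / (real p - 1))"
proof -
  define N where "N = Max (insert 0 M)"
  \<comment> \<open>\<open>restrict\<close> makes the exponent vector extensional, so that it lies
    in a \<open>PiE\<close> and \<open>prod_sum_PiE\<close> applies.\<close>
  define h where "h = (\<lambda>m. restrict (\<lambda>p. multiplicity p m) U)"
  have eq: "m = (\<Prod>p\<in>U. p ^ multiplicity p m)" if "m \<in> M" for m
    using assms(4)[OF that] by (metis prime_factorization_nat)
  have inj: "inj_on h M"
  proof (rule inj_onI)
    fix m n assume mn: "m \<in> M" "n \<in> M" "h m = h n"
    have "multiplicity p m = multiplicity p n" if "p \<in> U" for p
      using fun_cong[OF mn(3), of p] that by (simp add: h_def)
    thus "m = n" using eq[OF mn(1)] eq[OF mn(2)] by (metis (no_types, lifting) prod.cong)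
  qed
  have sub: "h ` M \<subseteq> PiE U (\<lambda>_. {1..N})"
  proof (intro image_subsetI PiE_I)
    fix m p assume m: "m \<in> M" and p: "p \<in> U"
    have "m \<le> N" unfolding N_def using m assms(1) by (intro Max_ge) auto
    moreover have "multiplicity p m < p ^ multiplicity p m"
      using prime_gt_1_nat[OF assms(3)[OF p]] by (intro power_gt_expt) auto
    moreover have "p ^ multiplicity p m \<le> m"
      using assms(4)[OF m] by (intro dvd_imp_le multiplicity_dvd) auto
    moreover have "multiplicity p m \<ge> 1"
      using assms(4)[OF m] p by (auto simp: prime_factors_multiplicity)
    ultimately show "h m p \<in> {1..N}" using p by (simp add: h_def)
  qed (auto simp: h_def)
  have "(\<Sum>m\<in>M. 1 / real m) = (\<Sum>m\<in>M. \<Prod>p\<in>U. (1 / real p) ^ h m p)"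
  proof (rule sum.cong)
    fix m assume m: "m \<in> M"
    have "1 / real m = 1 / real (\<Prod>p\<in>U. p ^ multiplicity p m)" using eq[OF m] by simp
    also have "\<dots> = (\<Prod>p\<in>U. (1 / real p) ^ h m p)"
      by (simp add: h_def prod_dividef power_one_over)
    finally show "1 / real m = (\<Prod>p\<in>U. (1 / real p) ^ h m p)" .
  qed auto
  also have "\<dots> = (\<Sum>g\<in>h ` M. \<Prod>p\<in>U. (1 / real p) ^ g p)"
    by (simp add: sum.reindex[OF inj])
  also have "\<dots> \<le> (\<Sum>g\<in>PiE U (\<lambda>_. {1..N}). \<Prod>p\<in>U. (1 / real p) ^ g p)"
    using sub assms(2) by (intro sum_mono2 finite_PiE prod_nonneg) auto
  also have "\<dots> = (\<Prod>p\<in>U. \<Sum>k\<in>{1..N}. (1 / real p) ^ k)"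
    using assms(2) by (intro prod_sum_PiE[symmetric]) auto
  also have "\<dots> \<le> (\<Prod>p\<in>U. 1 / (real p - 1))"
  proof (rule prod_mono, intro conjI sum_nonneg)
    fix p assume "p \<in> U"
    hence p: "real p > 1" using prime_gt_1_nat[OF assms(3)] by auto
    have "(\<Sum>k\<in>{1..N}. (1 / real p) ^ k) = (\<Sum>k<N. (1 / real p) * (1 / real p) ^ k)"
      by (rule sum.reindex_bij_witness[of _ Suc "\<lambda>k. k - 1"]) (auto simp: Suc_le_eq simp flip: power_Suc)
    also have "\<dots> = (1 / real p) * (\<Sum>k<N. (1 / real p) ^ k)" by (simp add: sum_distrib_left)
    also have "\<dots> \<le> (1 / real p) * (1 / (1 - 1 / real p))"
    proof (rule mult_left_mono)
      have "(\<Sum>k<N. (1 / real p) ^ k) \<le> (\<Sum>k. (1 / real p) ^ k)"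
        using p by (intro sum_le_suminf summable_geometric) auto
      also have "\<dots> = 1 / (1 - 1 / real p)"
        using p by (intro suminf_geometric) auto
      finally show "(\<Sum>k<N. (1 / real p) ^ k) \<le> 1 / (1 - 1 / real p)" .
    qed (use p in auto)
    also have "\<dots> = 1 / (real p - 1)" using p by (simp add: field_simps)
    finally show "(\<Sum>k\<in>{1..N}. (1 / real p) ^ k) \<le> 1 / (real p - 1)" .
  qed auto
  finally show ?thesis .
qed

text \<open>Barrier conditions see only the set of prime factors. Grouping integers by this set
  passes from integers to weighted sets of primes.\<close>

lemma sum_smooth_le:
  assumes "finite M" "finite Q" "\<And>p. p \<in> Q \<Longrightarrow> prime p"
    and "\<And>m. m \<in> M \<Longrightarrow> 0 < m \<and> prime_factors m \<subseteq> Q \<and> P (prime_factors m)"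
  shows "(\<Sum>m\<in>M. 1 / real m) \<le> (\<Sum>U | U \<subseteq> Q \<and> P U. \<Prod>p\<in>U. 1 / (real p - 1))"
proof -
  have fin: "finite {U. U \<subseteq> Q \<and> P U}"
    using assms(2) by (auto intro: finite_subset[of _ "Pow Q"])
  have "(\<Sum>m\<in>M. 1 / real m) = (\<Sum>U | U \<subseteq> Q \<and> P U. \<Sum>m\<in>{m\<in>M. prime_factors m = U}. 1 / real m)"
    by (rule sum.group[symmetric]) (use fin assms in auto)
  also have "\<dots> \<le> (\<Sum>U | U \<subseteq> Q \<and> P U. \<Prod>p\<in>U. 1 / (real p - 1))"
  proof (rule sum_mono)
    fix U assume U: "U \<in> {U. U \<subseteq> Q \<and> P U}"
    hence "finite U" using assms(2) finite_subset by auto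
    thus "(\<Sum>m\<in>{m\<in>M. prime_factors m = U}. 1 / real m) \<le> (\<Prod>p\<in>U. 1 / (real p - 1))"
      by (intro sum_inverse_same_support_le) (use U assms in auto)
  qed
  finally show ?thesis .
qed

section \<open>An explicit lower bound for the number of primes\<close>

text \<open>A new prime n + 1 multiplies the product by 1 + 1/n. As the bound so far is itself at
  most n, this adds at most 1, just as the cardinality does.\<close>

lemma prod_primes_le_card:
  "(\<Prod>p | prime p \<and> p \<le> n. 1 + 1 / (real p - 1)) \<le> real (card {p. prime p \<and> p \<le> n}) + 1"
proof (induction n)
  case 0
  have "{p :: nat. prime p \<and> p \<le> 0} = {}" by auto
  thus ?case by (simp only:) simp
next
  case (Suc n)
  define Q where "Q = {p. prime p \<and> p \<le> n}"
  have Q: "finite Q" unfolding Q_def by auto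
  show ?case
  proof (cases "prime (Suc n)")
    case True
    hence eq: "{p. prime p \<and> p \<le> Suc n} = insert (Suc n) Q" by (auto simp: le_Suc_eq Q_def)
    have nQ: "Suc n \<notin> Q" by (auto simp: Q_def)
    have n: "n \<ge> 1" using prime_gt_1_nat[OF True] by simp
    have "Q \<subseteq> {2..n}" unfolding Q_def by (auto dest: prime_ge_2_nat)
    hence "card Q \<le> card {2..n}" by (intro card_mono) auto
    hence le: "real (card Q) + 1 \<le> real n" using n by simp
    have "(\<Prod>p\<in>insert (Suc n) Q. 1 + 1 / (real p - 1)) = (1 + 1 / real n) * (\<Prod>p\<in>Q. 1 + 1 / (real p - 1))"
      using Q nQ by simp
    also have "\<dots> \<le> (1 + 1 / real n) * (real (card Q) + 1)"
      using Suc by (intro mult_left_mono) (auto simp: Q_def)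
    also have "\<dots> \<le> real (card Q) + 1 + 1" using le n by (simp add: field_simps)
    finally show ?thesis unfolding eq using Q nQ by simp
  next
    case False
    hence "{p. prime p \<and> p \<le> Suc n} = Q" by (auto simp: le_Suc_eq Q_def)
    thus ?thesis using Suc by (simp add: Q_def)
  qed
qed

lemma ln_le_harmonic_sum: "ln (real (Suc n)) \<le> (\<Sum>m=1..n. 1 / real m)"
proof (induction n)
  case (Suc n)
  have "ln (real (Suc (Suc n))) - ln (real (Suc n)) \<le> (real (Suc (Suc n)) - real (Suc n)) / real (Suc n)"
    by (rule ln_diff_le) auto
  thus ?case using Suc by simp
qed simp

text \<open>Euler's argument: the harmonic sum is at most the Euler product over the primes up to n.
  Unlike the Chebyshev bound it holds for every n with explicit constants, which the lower barrier
  needs at small t.\<close>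

lemma card_primes_ge_ln: "ln (real (Suc n)) \<le> real (card {p. prime p \<and> p \<le> n}) + 1"
proof -
  define Q where "Q = {p. prime p \<and> p \<le> n}"
  have Q: "finite Q" "\<And>p. p \<in> Q \<Longrightarrow> prime p" unfolding Q_def by auto
  have "ln (real (Suc n)) \<le> (\<Sum>m=1..n. 1 / real m)" by (rule ln_le_harmonic_sum)
  also have "\<dots> \<le> (\<Sum>U | U \<subseteq> Q \<and> True. \<Prod>p\<in>U. 1 / (real p - 1))"
  proof (rule sum_smooth_le)
    fix m assume m: "m \<in> {1..n}"
    have "prime_factors m \<subseteq> Q"
    proof
      fix p assume "p \<in> prime_factors m"
      hence "prime p" "p dvd m" by auto
      thus "p \<in> Q" using dvd_imp_le[of p m] m by (auto simp: Q_def)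
    qed
    thus "0 < m \<and> prime_factors m \<subseteq> Q \<and> True" using m by auto
  qed (use Q in auto)
  also have "\<dots> = (\<Prod>p\<in>Q. 1 + 1 / (real p - 1))"
    using prod_add[OF Q(1), of "\<lambda>p. 1 / (real p - 1)" "\<lambda>_. 1"] by (simp add: Pow_def add.commute)
  also have "\<dots> \<le> real (card Q) + 1" unfolding Q_def by (rule prod_primes_le_card)
  finally show ?thesis by (simp add: Q_def)
qed

section \<open>Random sets of primes\<close>

text \<open>The weight w is the odds of choosing a prime: w = 1 / (p - 1) gives probability 1 / p,
  and w = 1 / p gives 1 / (p + 1). Composite indices get probability 0 and hence trivial steps, so
  the walk can run over an interval of integers.\<close>

definition prime_prob :: "(nat \<Rightarrow> real) \<Rightarrow> nat \<Rightarrow> real" where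
  "prime_prob w i = (if prime i then w i / (1 + w i) else 0)"

text \<open>Dividing the weights by the total mass, the product of the \<open>1 + w p\<close>,
  yields the law of the random set; sets containing a composite have weight 0 there.\<close>

lemma sum_below_weights:
  assumes "a \<le> b" "\<And>p. prime p \<Longrightarrow> w p \<ge> 0"
  defines "Q \<equiv> {p. prime p \<and> a \<le> p \<and> p < b}"
  shows "(\<Sum>U | U \<subseteq> Q \<and> below s (prime_prob w) a b d U. \<Prod>p\<in>U. w p) =
     (\<Prod>p\<in>Q. 1 + w p) * stay s (map (prime_prob w) [a..<b]) d"
proof -
  define r where "r = prime_prob w"
  have Q: "Q \<subseteq> {a..<b}" "finite Q" unfolding Q_def by auto
  have fin: "finite {U. U \<subseteq> {a..<b} \<and> below s r a b d U}"
    by (rule finite_subset[of _ "Pow {a..<b}"]) auto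
  have "stay s (map r [a..<b]) d =
      (\<Sum>U | U \<subseteq> {a..<b} \<and> below s r a b d U. (\<Prod>i\<in>U. r i) * (\<Prod>i\<in>{a..<b} - U. 1 - r i))"
    using sum_below_eq_stay[OF assms(1)] by simp
  also have "\<dots> = (\<Sum>U | U \<subseteq> Q \<and> below s r a b d U. (\<Prod>i\<in>U. r i) * (\<Prod>i\<in>{a..<b} - U. 1 - r i))"
  proof (rule sum.mono_neutral_right[OF fin])
    show "{U. U \<subseteq> Q \<and> below s r a b d U} \<subseteq> {U. U \<subseteq> {a..<b} \<and> below s r a b d U}"
      using Q by auto
    show "\<forall>U\<in>{U. U \<subseteq> {a..<b} \<and> below s r a b d U} - {U. U \<subseteq> Q \<and> below s r a b d U}.
        (\<Prod>i\<in>U. r i) * (\<Prod>i\<in>{a..<b} - U. 1 - r i) = 0"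
    proof
      fix U assume U: "U \<in> {U. U \<subseteq> {a..<b} \<and> below s r a b d U} - {U. U \<subseteq> Q \<and> below s r a b d U}"
      then obtain i where i: "i \<in> U" "i \<notin> Q" by auto
      hence "r i = 0" using U unfolding r_def prime_prob_def Q_def by auto
      moreover have "finite U" using U finite_subset[of U "{a..<b}"] by auto
      ultimately have "(\<Prod>i\<in>U. r i) = 0" using i by (auto intro: prod_zero)
      thus "(\<Prod>i\<in>U. r i) * (\<Prod>i\<in>{a..<b} - U. 1 - r i) = 0" by simp
    qed
  qed
  finally have "(\<Prod>p\<in>Q. 1 + w p) * stay s (map r [a..<b]) d =
      (\<Sum>U | U \<subseteq> Q \<and> below s r a b d U. (\<Prod>p\<in>Q. 1 + w p) * ((\<Prod>i\<in>U. r i) * (\<Prod>i\<in>{a..<b} - U. 1 - r i)))"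
    by (simp add: sum_distrib_left)
  also have "\<dots> = (\<Sum>U | U \<subseteq> Q \<and> below s r a b d U. \<Prod>p\<in>U. w p)"
  proof (rule sum.cong)
    fix U assume "U \<in> {U. U \<subseteq> Q \<and> below s r a b d U}"
    hence U: "U \<subseteq> Q" by simp
    have pr: "prime p" if "p \<in> Q" for p using that by (simp add: Q_def)
    have pos: "1 + w p > 0" if "p \<in> Q" for p using assms(2)[OF pr[OF that]] by simp
    have "(\<Prod>i\<in>{a..<b} - U. 1 - r i) = (\<Prod>i\<in>Q - U. 1 - r i)"
      using Q by (intro prod.mono_neutral_right) (auto simp: r_def prime_prob_def Q_def)
    also have "\<dots> = (\<Prod>i\<in>Q - U. 1 / (1 + w i))"
      by (intro prod.cong) (auto simp: r_def prime_prob_def pr field_simps dest!: pos)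
    finally have 1: "(\<Prod>i\<in>{a..<b} - U. 1 - r i) = (\<Prod>i\<in>Q - U. 1 / (1 + w i))" .
    have 2: "(\<Prod>i\<in>U. r i) = (\<Prod>i\<in>U. w i / (1 + w i))"
      using U pr by (intro prod.cong) (auto simp: r_def prime_prob_def)
    have 3: "(\<Prod>p\<in>Q. 1 + w p) = (\<Prod>p\<in>Q - U. 1 + w p) * (\<Prod>p\<in>U. 1 + w p)"
      by (rule prod.subset_diff) (use U Q in auto)
    have "(\<Prod>p\<in>Q - U. 1 + w p) * (\<Prod>i\<in>Q - U. 1 / (1 + w i)) = (\<Prod>p\<in>Q - U. 1)"
      unfolding prod.distrib[symmetric] by (intro prod.cong) (auto dest!: pos)
    moreover have "(\<Prod>p\<in>U. 1 + w p) * (\<Prod>i\<in>U. w i / (1 + w i)) = (\<Prod>p\<in>U. w p)"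
      unfolding prod.distrib[symmetric]
    proof (rule prod.cong)
      fix p assume "p \<in> U"
      hence "1 + w p > 0" using U pos by auto
      thus "(1 + w p) * (w p / (1 + w p)) = w p" by simp
    qed auto
    ultimately show "(\<Prod>p\<in>Q. 1 + w p) * ((\<Prod>i\<in>U. r i) * (\<Prod>i\<in>{a..<b} - U. 1 - r i)) = (\<Prod>p\<in>U. w p)"
      unfolding 1 2 3 by (simp add: mult_ac)
  qed auto
  finally show ?thesis by (simp add: r_def)
qed

section \<open>Upper bounds\<close>

lemma walk_var_map_upt: "walk_var (map r [a..<b]) = (\<Sum>i\<in>{a..<b}. r i * (1 - r i))"
  unfolding walk_var_def map_map o_def by (simp add: interv_sum_list_conv_sum_set_nat)

lemma walk_var_prime_prob:
  "walk_var (map (prime_prob w) [a..<b]) =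
     (\<Sum>p | prime p \<and> a \<le> p \<and> p < b. prime_prob w p * (1 - prime_prob w p))"
  unfolding walk_var_map_upt by (rule sum.mono_neutral_right) (auto simp: prime_prob_def)

lemma prime_prob_bounds: "(\<And>p. prime p \<Longrightarrow> w p \<ge> 0) \<Longrightarrow> set (map (prime_prob w) xs) \<subseteq> {0..1}"
proof -
  assume w: "\<And>p. prime p \<Longrightarrow> w p \<ge> 0"
  have "prime_prob w i \<in> {0..1}" for i
    using w[of i] by (auto simp: prime_prob_def divide_le_eq_1)
  thus ?thesis by auto
qed

lemma sum_prime_prob:
  "(\<Sum>i\<in>{a..<b}. prime_prob w i) = (\<Sum>p | prime p \<and> a \<le> p \<and> p < b. prime_prob w p)"
  by (rule sum.mono_neutral_right) (auto simp: prime_prob_def)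

lemma lnln_floor:
  assumes "t \<ge> (2 :: real)"
  defines "n \<equiv> nat \<lfloor>t\<rfloor>"
  shows "n \<ge> 2" "real n \<le> t" "t < real n + 1" "ln (ln (real n)) \<le> ln (ln t)" "ln (ln t) \<le> ln (ln (real n)) + 1"
proof -
  show n: "n \<ge> 2" "real n \<le> t" "t < real n + 1" using assms by (auto simp: n_def le_nat_floor)
  show "ln (ln (real n)) \<le> ln (ln t)" using n by simp
  have "real n + 1 \<le> real n ^ 2" using n mult_right_mono[of 2 "real n" "real n"] unfolding power2_eq_square by linarith
  hence "t \<le> real n ^ 2" using n by linarith
  hence "ln t \<le> ln (real n ^ 2)" using assms(1) n(1) by (subst ln_le_cancel_iff) auto
  also have "\<dots> = 2 * ln (real n)" using n by (simp add: ln_realpow)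
  finally have "ln (ln t) \<le> ln (2 * ln (real n))" using n(1) assms(1) by (subst ln_le_cancel_iff) auto
  also have "\<dots> = ln 2 + ln (ln (real n))" using n by (subst ln_mult_pos) auto
  finally show "ln (ln t) \<le> ln (ln (real n)) + 1" using ln_2_le_1 by linarith
qed

text \<open>One family for both upper bounds, with the sign s as in \<open>stay\<close>. It omits
  the maximum with 0, so that cancelling a prime power from n only shifts d by 1.\<close>

definition barrier :: "real \<Rightarrow> real \<Rightarrow> real \<Rightarrow> nat set" where
  "barrier s x d = {n. n \<ge> 1 \<and> real n \<le> x \<and>
     (\<forall>t. 2 \<le> t \<and> t \<le> x \<longrightarrow> s * (real (omega n t) - loglog t) \<le> d)}"

lemma barrier_subset: "barrier s x d \<subseteq> {1..nat \<lfloor>x\<rfloor>}"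
  by (auto simp: barrier_def le_nat_floor)

lemma finite_barrier [simp]: "finite (barrier s x d)"
  by (rule finite_subset[OF barrier_subset]) simp

lemma loglog_ge_minus_1:
  assumes "t \<ge> 2"
  shows "loglog t \<ge> -1"
proof -
  have "ln (1 / 2 :: real) \<le> 1 / 2 - 1" by (rule ln_le_minus_one) simp
  hence "ln 2 \<ge> (1 / 2 :: real)" by (simp add: ln_div)
  moreover have "ln 2 \<le> ln t" using assms by simp
  ultimately have t: "ln t \<ge> 1 / 2" by linarith
  have "ln (1 / ln t) \<le> 1 / ln t - 1" using t by (intro ln_le_minus_one) simp
  moreover have "1 / ln t \<le> 2" using t by (simp add: field_simps)
  moreover have "ln (1 / ln t) = - ln (ln t)" using t by (simp add: ln_div)
  ultimately show ?thesis by (simp add: loglog_def)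
qed

text \<open>Where the maximum is 0 there are no prime factors up to t, and \<open>loglog t\<close>
  \<ge> -1 for t \<ge> 2; raising the barrier by 1 therefore suffices.\<close>

lemma upper_barrier_set_subset:
  assumes "\<beta> \<ge> 0"
  shows "upper_barrier_set x \<beta> \<subseteq> barrier 1 x (\<beta> + 1)"
proof
  fix n assume n: "n \<in> upper_barrier_set x \<beta>"
  have "1 * (real (omega n t) - loglog t) \<le> \<beta> + 1" if t: "2 \<le> t" "t \<le> x" for t
  proof -
    have "real (omega n t) \<le> max 0 (loglog t + \<beta>)" using n t by (auto simp: upper_barrier_set_def)
    thus ?thesis using loglog_ge_minus_1[OF t(1)] assms by (auto simp: max_def split: if_splits)
  qed
  thus "n \<in> barrier 1 x (\<beta> + 1)" using n by (auto simp: upper_barrier_set_def barrier_def)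
qed

lemma lower_barrier_set_subset: "lower_barrier_set x \<beta> \<subseteq> barrier (-1) x (\<beta> + 1)"
proof
  fix n assume n: "n \<in> lower_barrier_set x \<beta>"
  have "-1 * (real (omega n t) - loglog t) \<le> \<beta> + 1" if t: "2 \<le> t" "t \<le> x" for t
  proof -
    have "real (omega n t) \<ge> loglog t - \<beta>" using n t by (auto simp: lower_barrier_set_def)
    thus ?thesis by simp
  qed
  thus "n \<in> barrier (-1) x (\<beta> + 1)" using n by (auto simp: lower_barrier_set_def barrier_def)
qed

lemma omega_mult_primepow:
  assumes "m > 0" "primepow e"
  shows "omega m t \<le> omega (m * e) t" "omega (m * e) t \<le> omega m t + 1"
proof -
  obtain p k where p: "prime p" "k > 0" "e = p ^ k" using assms(2) unfolding primepow_def by blast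
  hence pf: "prime_factors (m * e) = insert p (prime_factors m)"
    using assms by (simp add: prime_factors_product prime_factorization_prime_power)
  have fin: "finite {q \<in> prime_factors m. real q \<le> t}" by auto
  show "omega m t \<le> omega (m * e) t"
    unfolding omega_def pf by (rule card_mono) auto
  have "omega (m * e) t \<le> card (insert p {q \<in> prime_factors m. real q \<le> t})"
    unfolding omega_def pf using fin by (intro card_mono) auto
  also have "\<dots> \<le> omega m t + 1"
    unfolding omega_def using fin by (simp add: card_insert_if)
  finally show "omega (m * e) t \<le> omega m t + 1" .
qed

text \<open>Expanding \<open>ln n\<close> as a sum of von Mangoldt values over the divisors of \<open>n\<close> and
  cancelling the prime power trades the counting measure for the measure \<open>1/m\<close>.\<close>

lemma sum_ln_barrier_le:
  assumes "\<bar>s\<bar> = 1" "x \<ge> 0"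
  shows "(\<Sum>n\<in>barrier s x d. ln (real n)) \<le> 4 * x * (\<Sum>m\<in>barrier s x (d + 1). 1 / real m)"
proof -
  define A where "A = barrier s x d"
  define A' where "A' = barrier s x (d + 1)"
  define N where "N = nat \<lfloor>x\<rfloor>"
  define D where "D = (\<lambda>n::nat. {e. e dvd n \<and> primepow e})"
  define E where "E = (\<lambda>m. {1..N div m})"
  define h where "h = (\<lambda>(n, e). (n div e, e :: nat))"
  have N: "real N \<le> x" using assms by (simp add: N_def)
  have A1: "n \<ge> 1" "n \<le> N" if "n \<in> A" for n
    using barrier_subset[of s x d] that by (auto simp: A_def N_def)
  have finD: "finite (D n)" if "n \<in> A" for n
    using A1[OF that] by (intro finite_subset[OF _ finite_divisors_nat[of n]]) (auto simp: D_def)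
  have "(\<Sum>n\<in>A. ln (real n)) = (\<Sum>n\<in>A. \<Sum>e\<in>D n. mangoldt e)"
  proof (rule sum.cong)
    fix n assume n: "n \<in> A"
    have "ln (real n) = (\<Sum>e | e dvd n. mangoldt e)"
      using mangoldt_sum[of n, where ?'a = real] A1[OF n] by simp
    also have "\<dots> = (\<Sum>e\<in>D n. mangoldt e)"
      using A1[OF n] by (intro sum.mono_neutral_right) (auto simp: D_def mangoldt_def)
    finally show "ln (real n) = (\<Sum>e\<in>D n. mangoldt e)" .
  qed auto
  also have "\<dots> = (\<Sum>(n, e)\<in>Sigma A D. mangoldt e)"
    using finD by (intro sum.Sigma) (auto simp: A_def)
  also have "\<dots> = (\<Sum>(m, e)\<in>h ` Sigma A D. mangoldt e)"
  proof -
    have "inj_on h (Sigma A D)"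
      by (rule inj_onI) (auto simp: h_def D_def dvd_def)
    thus ?thesis by (subst sum.reindex) (auto simp: h_def case_prod_beta intro!: sum.cong)
  qed
  \<comment> \<open>The barrier is kept for the cofactor m only, and e may be any integer up to N
    div m. The inner sum is then a value of \<open>psi\<close>.\<close>
  also have "\<dots> \<le> (\<Sum>(m, e)\<in>Sigma A' E. mangoldt e)"
  proof (rule sum_mono2)
    show "finite (Sigma A' E)" by (auto simp: A'_def E_def)
    show "h ` Sigma A D \<subseteq> Sigma A' E"
    proof clarify
      fix n e m e' assume n: "n \<in> A" and e: "e \<in> D n" and me: "(m, e') = h (n, e)"
      hence m: "m = n div e" "e' = e" by (auto simp: h_def)
      have pe: "primepow e" "e dvd n" using e by (auto simp: D_def)
      have n_eq: "n = m * e" using pe m by simp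
      have m1: "m > 0" "e > 0" using n_eq A1[OF n] by (auto intro!: Nat.gr0I)
      have "m \<le> n" using n_eq m1 by simp
      have "s * (real (omega m t) - loglog t) \<le> d + 1" if t: "2 \<le> t" "t \<le> x" for t
      proof -
        have "s * (real (omega n t) - loglog t) \<le> d"
          using n t by (auto simp: A_def barrier_def)
        moreover have "s * (real (omega m t) - real (omega n t)) \<le> \<bar>s * (real (omega m t) - real (omega n t))\<bar>" by simp
        moreover have "\<dots> \<le> 1"
          using omega_mult_primepow[OF m1(1) pe(1), of t] assms(1) unfolding n_eq abs_mult by simp
        ultimately show ?thesis by (simp add: algebra_simps)
      qed
      moreover have "real m \<le> x" using \<open>m \<le> n\<close> A1[OF n] N by linarith
      ultimately have "m \<in> A'" using m1 by (auto simp: A'_def barrier_def)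
      moreover have "e * m \<le> N" using A1[OF n] n_eq by (simp add: mult.commute)
      hence "e \<le> N div m" using m1 by (simp add: less_eq_div_iff_mult_less_eq)
      ultimately show "m \<in> A' \<and> e' \<in> E m" using m m1 by (auto simp: E_def)
    qed
  qed (auto simp: mangoldt_nonneg)
  also have "\<dots> = (\<Sum>m\<in>A'. psi (N div m))"
    unfolding psi_def E_def by (intro sum.Sigma[symmetric]) (auto simp: A'_def)
  also have "\<dots> \<le> (\<Sum>m\<in>A'. 4 * x * (1 / real m))"
  proof (rule sum_mono)
    fix m assume "m \<in> A'"
    hence m: "m \<ge> 1" by (auto simp: A'_def barrier_def)
    have "psi (N div m) \<le> 4 * real (N div m)" by (rule psi_le)
    also have "real (N div m) \<le> real N / real m" by (rule of_nat_div_le_of_nat)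
    also have "\<dots> \<le> x / real m" using N by (intro divide_right_mono) auto
    finally show "psi (N div m) \<le> 4 * x * (1 / real m)" by simp
  qed
  finally show ?thesis by (simp add: A_def A'_def sum_distrib_left)
qed

text \<open>With odds 1 / (p - 1), which account for all powers of p, the probabilities are exactly
  1 / p and the drift is the sum in Mertens' second theorem. The barrier thus becomes a fixed level
  d + M for the walk; the factor ln x is the total mass.\<close>

lemma sum_inverse_barrier_le:
  "\<exists>C>0. \<exists>x0. \<forall>x\<ge>x0. \<forall>s d. \<bar>s\<bar> = 1 \<longrightarrow> d \<ge> 0 \<longrightarrow>
     (\<Sum>m\<in>barrier s x d. 1 / real m) \<le> C * (d + 1) * ln x / sqrt (loglog x)"
proof -
  obtain M where M0: "M \<ge> 0" and M: "\<And>n. n \<ge> 2 \<Longrightarrow> \<bar>(\<Sum>p | prime p \<and> p \<le> n. 1 / real p) - ln (ln (real n))\<bar> \<le> M"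
    using mertens_second by blast
  obtain C1 where C1: "C1 > 0" "\<And>n. n \<ge> 2 \<Longrightarrow> (\<Prod>p | prime p \<and> p \<le> n. 1 + 1 / (real p - 1)) \<le> C1 * ln (real n)"
    using prod_primes_upper by blast
  \<comment> \<open>The loss M + 2 in the variance consists of M from Mertens' theorem, 1 from
    rounding x to N, and 1 from the squares of the probabilities. A quarter of L is kept, whence
    \<sigma> = sqrt L / 2 in \<open>stay_le\<close>.\<close>
  have "eventually (\<lambda>x::real. x \<ge> 2 \<and> ln (ln x) \<ge> 1 \<and> ln (ln x) / 4 \<le> ln (ln x) - M - 2) at_top"
    by (intro eventually_conj; real_asymp)
  then obtain x0 :: real where x0: "\<And>x. x \<ge> x0 \<Longrightarrow> x \<ge> 2 \<and> ln (ln x) \<ge> 1 \<and> ln (ln x) / 4 \<le> ln (ln x) - M - 2"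
    unfolding eventually_at_top_linorder by blast
  define w :: "nat \<Rightarrow> real" where "w = (\<lambda>p. 1 / (real p - 1))"
  have w: "1 / (real p - 1) = w p" for p by (simp add: w_def)
  have p2: "real p \<ge> 2" if "prime p" for p :: nat using prime_ge_2_nat[OF that] by simp
  have w0: "w p \<ge> 0" if "prime p" for p using p2[OF that] by (simp add: w_def)
  have r: "prime_prob w p = 1 / real p" if "prime p" for p
    using p2[OF that] that by (simp add: prime_prob_def w_def field_simps)
  have "(\<Sum>m\<in>barrier s x d. 1 / real m) \<le> 4 * C1 * (M + 2) * (d + 1) * ln x / sqrt (loglog x)"
    if x: "x \<ge> x0" and s: "\<bar>s\<bar> = 1" and d: "d \<ge> 0" for x s d
  proof -
    define N where "N = nat \<lfloor>x\<rfloor>"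
    define L where "L = ln (ln x)"
    define Q where "Q = {p. prime p \<and> 2 \<le> p \<and> p < Suc N}"
    define d' where "d' = d + M"
    have x2: "x \<ge> 2" and L: "L \<ge> 1" "L / 4 \<le> L - M - 2" using x0[OF x] by (auto simp: L_def)
    note N = lnln_floor[OF x2, folded N_def]
    have Q: "finite Q" "\<And>p. p \<in> Q \<Longrightarrow> prime p" "Q \<subseteq> {2..}" "Q = {p. prime p \<and> p \<le> N}"
      unfolding Q_def by (auto dest: prime_ge_2_nat)
    have "(\<Sum>m\<in>barrier s x d. 1 / real m) \<le>
        (\<Sum>U | U \<subseteq> Q \<and> below s (prime_prob w) 2 (Suc N) d' U. \<Prod>p\<in>U. 1 / (real p - 1))"
    proof (rule sum_smooth_le)
      fix m assume m: "m \<in> barrier s x d"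
      have m1: "m > 0" "m \<le> N" using barrier_subset[of s x d] m by (auto simp: N_def)
      have pf: "prime_factors m \<subseteq> Q"
      proof
        fix p assume "p \<in> prime_factors m"
        hence p: "prime p" "p dvd m" by auto
        hence "p \<le> N" using dvd_imp_le[of p m] m1 by linarith
        thus "p \<in> Q" using p prime_ge_2_nat[of p] by (auto simp: Q_def)
      qed
      have "s * (real (card (prime_factors m \<inter> {2..<k})) - (\<Sum>i\<in>{2..<k}. prime_prob w i)) \<le> d'"
        if k: "k \<in> {2..Suc N}" for k
      proof (cases "k = 2")
        case True
        thus ?thesis using d M0 by (simp add: d'_def)
      next
        case False
        \<comment> \<open>The half-open prefix up to k corresponds to the cutoff t = k - 1. The
          empty prefix k = 2 was treated apart because the barrier says nothing about t = 1.\<close>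
        define j where "j = k - 1"
        have j: "j \<ge> 2" "k = Suc j" "j \<le> N" using k False by (auto simp: j_def)
        have "prime_factors m \<inter> {2..<k} = {p \<in> prime_factors m. real p \<le> real j}"
          using pf j by (auto simp: Q_def)
        hence card: "card (prime_factors m \<inter> {2..<k}) = omega m (real j)" by (simp add: omega_def)
        have "{p. prime p \<and> 2 \<le> p \<and> p < k} = {p. prime p \<and> p \<le> j}"
          using j by (auto dest: prime_ge_2_nat)
        hence sm: "(\<Sum>i\<in>{2..<k}. prime_prob w i) = (\<Sum>p | prime p \<and> p \<le> j. 1 / real p)"
          unfolding sum_prime_prob by (auto intro!: sum.cong simp: r)
        have "s * (real (omega m (real j)) - loglog (real j)) \<le> d"
          using m j N by (auto simp: barrier_def)
        moreover have "s * (loglog (real j) - (\<Sum>p | prime p \<and> p \<le> j. 1 / real p)) \<le>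
            \<bar>s * (loglog (real j) - (\<Sum>p | prime p \<and> p \<le> j. 1 / real p))\<bar>" by simp
        moreover have "\<dots> \<le> M" using M[OF j(1)] s by (simp add: abs_mult loglog_def abs_minus_commute)
        ultimately show ?thesis unfolding card sm d'_def by (simp add: algebra_simps)
      qed
      hence "below s (prime_prob w) 2 (Suc N) d' (prime_factors m)" unfolding below_def by blast
      thus "0 < m \<and> prime_factors m \<subseteq> Q \<and> below s (prime_prob w) 2 (Suc N) d' (prime_factors m)"
        using m1 pf by blast
    qed (use Q(1,2) in simp_all)
    also have "\<dots> = (\<Prod>p\<in>Q. 1 + w p) * stay s (map (prime_prob w) [2..<Suc N]) d'"
      unfolding w Q_def by (rule sum_below_weights) (use w0 N(1) in auto)
    also have "\<dots> \<le> (C1 * ln x) * (4 * (M + 2) * (d + 1) / sqrt L)"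
    proof (rule mult_mono)
      have "(\<Prod>p\<in>Q. 1 + 1 / (real p - 1)) \<le> C1 * ln (real N)" unfolding Q(4) by (rule C1(2)) fact
      also have "\<dots> \<le> C1 * ln x" using C1(1) N by (intro mult_left_mono) auto
      finally show "(\<Prod>p\<in>Q. 1 + w p) \<le> C1 * ln x" unfolding w .
      have "(sqrt L / 2)\<^sup>2 \<le> walk_var (map (prime_prob w) [2..<Suc N])"
      proof -
        have "(sqrt L / 2)\<^sup>2 = L / 4" using L by (simp add: power_divide)
        also have "\<dots> \<le> (\<Sum>p\<in>Q. 1 / real p) - 1"
          using L M[OF N(1)] N(5) unfolding Q(4) L_def by linarith
        also have "\<dots> \<le> (\<Sum>p\<in>Q. 1 / real p) - (\<Sum>p\<in>Q. 1 / (real p * (real p - 1)))"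
          using sum_telescope_inverse_le_1[OF Q(1,3)] by simp
        also have "\<dots> = (\<Sum>p\<in>Q. 1 / real p - 1 / (real p * (real p - 1)))" by (simp add: sum_subtractf)
        also have "\<dots> \<le> (\<Sum>p\<in>Q. prime_prob w p * (1 - prime_prob w p))"
        proof (rule sum_mono)
          fix p assume "p \<in> Q"
          hence p: "prime p" "real p \<ge> 2" using Q(2) p2 by auto
          have "1 / (real p * real p) \<le> 1 / (real p * (real p - 1))"
            using p by (intro divide_left_mono mult_left_mono mult_pos_pos) auto
          thus "1 / real p - 1 / (real p * (real p - 1)) \<le> prime_prob w p * (1 - prime_prob w p)"
            using p by (simp add: r algebra_simps)
        qed
        also have "\<dots> = walk_var (map (prime_prob w) [2..<Suc N])"
          unfolding walk_var_prime_prob Q_def ..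
        finally show ?thesis .
      qed
      hence "stay s (map (prime_prob w) [2..<Suc N]) d' \<le> 2 * (d' + 1) / (sqrt L / 2)"
        using s L d M0 w0 by (intro stay_le prime_prob_bounds) (auto simp: d'_def)
      also have "\<dots> = 4 * (d' + 1) / sqrt L" by simp
      also have "\<dots> \<le> 4 * ((M + 2) * (d + 1)) / sqrt L"
        using d M0 L mult_nonneg_nonneg[OF M0 d] by (intro divide_right_mono mult_left_mono) (auto simp: d'_def algebra_simps)
      finally show "stay s (map (prime_prob w) [2..<Suc N]) d' \<le> 4 * (M + 2) * (d + 1) / sqrt L"
        by (simp only: mult.assoc)
      show "0 \<le> C1 * ln x" using C1 x2 by auto
      show "0 \<le> stay s (map (prime_prob w) [2..<Suc N]) d'"
        using w0 by (intro stay_nonneg prime_prob_bounds) auto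
    qed
    finally show ?thesis by (simp add: L_def loglog_def mult_ac)
  qed
  thus ?thesis using C1(1) M0 by (intro exI[of _ "4 * C1 * (M + 2)"] conjI exI[of _ x0]) auto
qed

text \<open>For n > sqrt x the weight ln n is at least (ln x) / 2, so the count follows from the
  logarithmic sum, the two factors ln x cancelling. The at most sqrt x smaller n are
  negligible.\<close>

lemma card_barrier_le:
  "\<exists>C>0. \<exists>x0. \<forall>x\<ge>x0. \<forall>s d. \<bar>s\<bar> = 1 \<longrightarrow> d \<ge> 0 \<longrightarrow>
     real (card (barrier s x d)) \<le> C * ((d + 1) * x / sqrt (loglog x))"
proof -
  obtain C x0 where C: "C > 0" and
    bd: "\<And>x s d. x \<ge> x0 \<Longrightarrow> \<bar>s\<bar> = 1 \<Longrightarrow> d \<ge> 0 \<Longrightarrow>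
     (\<Sum>m\<in>barrier s x d. 1 / real m) \<le> C * (d + 1) * ln x / sqrt (loglog x)"
    using sum_inverse_barrier_le by blast
  have "eventually (\<lambda>x::real. x \<ge> 2 \<and> ln (ln x) \<ge> 1 \<and> sqrt x \<le> x / sqrt (ln (ln x))) at_top"
    by (intro eventually_conj; real_asymp)
  then obtain x1 :: real where x1: "\<And>x. x \<ge> x1 \<Longrightarrow> x \<ge> 2 \<and> ln (ln x) \<ge> 1 \<and> sqrt x \<le> x / sqrt (ln (ln x))"
    unfolding eventually_at_top_linorder by blast
  have "real (card (barrier s x d)) \<le> (16 * C + 1) * ((d + 1) * x / sqrt (loglog x))"
    if x: "x \<ge> max x0 x1" and s: "\<bar>s\<bar> = 1" and d: "d \<ge> 0" for x s d
  proof -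
    define A where "A = barrier s x d"
    define B where "B = {n\<in>A. real n > sqrt x}"
    define q where "q = sqrt (loglog x)"
    have x2: "x \<ge> 2" "loglog x \<ge> 1" "sqrt x \<le> x / q" using x1[of x] x by (auto simp: loglog_def q_def)
    have q: "q > 0" using x2 by (simp add: q_def)
    have lnx: "ln x > 0" using x2 by simp
    have "n \<le> nat \<lfloor>sqrt x\<rfloor>" if "real n \<le> sqrt x" for n using that by (rule le_nat_floor)
    hence "A \<subseteq> B \<union> {1..nat \<lfloor>sqrt x\<rfloor>}" by (force simp: A_def B_def barrier_def)
    hence "card A \<le> card (B \<union> {1..nat \<lfloor>sqrt x\<rfloor>})" by (intro card_mono) (auto simp: B_def A_def)
    also have "\<dots> \<le> card B + nat \<lfloor>sqrt x\<rfloor>" using card_Un_le[of B "{1..nat \<lfloor>sqrt x\<rfloor>}"] by simp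
    finally have "real (card A) \<le> real (card B) + real (nat \<lfloor>sqrt x\<rfloor>)" by linarith
    also have "real (nat \<lfloor>sqrt x\<rfloor>) \<le> sqrt x" using x2 by simp
    also have "sqrt x \<le> (d + 1) * x / q"
    proof -
      have "1 * (x / q) \<le> (d + 1) * (x / q)" using x2 q d by (intro mult_right_mono) auto
      thus ?thesis using x2 by simp
    qed
    also have "real (card B) \<le> 16 * C * ((d + 1) * x / q)"
    proof -
      have "real (card B) * (ln x / 2) = (\<Sum>n\<in>B. ln x / 2)" by simp
      also have "\<dots> \<le> (\<Sum>n\<in>B. ln (real n))"
      proof (rule sum_mono)
        fix n assume "n \<in> B"
        hence n: "real n > sqrt x" by (simp add: B_def)
        have "ln x / 2 = ln (sqrt x)" using x2 by (simp add: ln_sqrt)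
        also have "\<dots> \<le> ln (real n)" using n x2 less_trans[of 0 "sqrt x" "real n"] by (subst ln_le_cancel_iff) auto
        finally show "ln x / 2 \<le> ln (real n)" .
      qed
      also have "\<dots> \<le> (\<Sum>n\<in>A. ln (real n))"
      proof (rule sum_mono2)
        fix n assume "n \<in> A - B"
        thus "0 \<le> ln (real n)" by (auto simp: A_def barrier_def)
      qed (auto simp: A_def B_def)
      also have "\<dots> \<le> 4 * x * (\<Sum>m\<in>barrier s x (d + 1). 1 / real m)"
        unfolding A_def using s x2 by (intro sum_ln_barrier_le) auto
      also have "\<dots> \<le> 4 * x * (C * (d + 1 + 1) * ln x / q)"
        unfolding q_def using x2 x s d by (intro mult_left_mono bd) auto
      also have "\<dots> = (4 * C * (d + 2) * x / q * 2) * (ln x / 2)" by simp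
      finally have "real (card B) \<le> 4 * C * (d + 2) * x / q * 2" using lnx by (subst (asm) mult_le_cancel_right) auto
      also have "\<dots> = 8 * C * ((d + 2) * x / q)" by simp
      also have "\<dots> \<le> 8 * C * ((2 * (d + 1)) * x / q)"
        using C q x2 d by (intro mult_left_mono divide_right_mono mult_right_mono) auto
      also have "\<dots> = 16 * C * ((d + 1) * x / q)" by (simp add: algebra_simps)
      finally show ?thesis .
    qed
    finally show ?thesis by (simp add: A_def q_def algebra_simps add_divide_distrib)
  qed
  thus ?thesis using C by (intro exI[of _ "16 * C + 1"] conjI exI[of _ "max x0 x1"]) auto
qed

section \<open>Lower bounds\<close>

lemma below_remove:
  assumes "\<bar>s\<bar> = 1" "finite U" "below s r a b d U"
  shows "below s r a b (d + 1) (U - {p})"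
  unfolding below_def
proof
  fix k assume k: "k \<in> {a..b}"
  define c where "c = card (U \<inter> {a..<k})"
  define c' where "c' = card ((U - {p}) \<inter> {a..<k})"
  have eq: "(U - {p}) \<inter> {a..<k} = U \<inter> {a..<k} - {p}" by auto
  have "c' \<le> c" unfolding c_def c'_def eq by (rule card_Diff1_le)
  moreover have "card (U \<inter> {a..<k} - {p}) \<ge> card (U \<inter> {a..<k}) - card {p}" by (rule diff_card_le_card_Diff) simp
  hence "c \<le> c' + 1" unfolding c_def c'_def eq by simp
  ultimately have "\<bar>real c' - real c\<bar> \<le> 1" by linarith
  hence "\<bar>s * (real c' - real c)\<bar> \<le> 1" by (simp add: abs_mult assms(1))
  hence "s * (real c' - real c) \<le> 1" by (rule order_trans[OF abs_ge_self])
  moreover have "s * (real c - (\<Sum>i\<in>{a..<k}. r i)) \<le> d"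
    using assms(3) k by (auto simp: below_def c_def)
  ultimately have "s * (real c' - (\<Sum>i\<in>{a..<k}. r i)) \<le> d + 1" by (simp add: algebra_simps)
  thus "s * (real (card ((U - {p}) \<inter> {a..<k})) - (\<Sum>i\<in>{a..<k}. r i)) \<le> d + 1" by (simp add: c'_def)
qed

text \<open>Rankin's trick with \<open>ln (\<Prod>U) = (\<Sum>p\<in>U. ln p)\<close>.\<close>

lemma sum_below_large_le:
  assumes "\<bar>s\<bar> = 1" "finite Q" "\<And>p. p \<in> Q \<Longrightarrow> prime p" "X > 1"
  defines "w \<equiv> \<lambda>U :: nat set. \<Prod>p\<in>U. 1 / real p"
  shows "(\<Sum>U | U \<subseteq> Q \<and> below s r a b d U \<and> real (\<Prod>U) > X. w U) \<le>
     (\<Sum>p\<in>Q. ln (real p) / real p) / ln X * (\<Sum>U | U \<subseteq> Q \<and> below s r a b (d + 1) U. w U)"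
proof -
  define G where "G = (\<lambda>d. {U. U \<subseteq> Q \<and> below s r a b d U})"
  have fin: "finite (G d)" for d
    unfolding G_def by (rule finite_subset[of _ "Pow Q"]) (use assms(2) in auto)
  have lnX: "ln X > 0" using assms(4) by simp
  have p1: "real p > 1" if "p \<in> Q" for p using prime_gt_1_nat[OF assms(3)[OF that]] by simp
  have w0: "w U \<ge> 0" for U unfolding w_def by (intro prod_nonneg) auto
  have fU: "finite U" if "U \<in> G d" for U d using that assms(2) finite_subset by (auto simp: G_def)
  have "ln X * (\<Sum>U | U \<subseteq> Q \<and> below s r a b d U \<and> real (\<Prod>U) > X. w U) =
      (\<Sum>U\<in>{U\<in>G d. real (\<Prod>U) > X}. ln X * w U)"
    unfolding sum_distrib_left G_def by (intro sum.cong) auto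
  also have "\<dots> \<le> (\<Sum>U\<in>{U\<in>G d. real (\<Prod>U) > X}. (\<Sum>p\<in>U. ln (real p)) * w U)"
  proof (intro sum_mono mult_right_mono w0)
    fix U assume U: "U \<in> {U\<in>G d. real (\<Prod>U) > X}"
    hence UQ: "U \<subseteq> Q" by (auto simp: G_def)
    have "ln X \<le> ln (real (\<Prod>U))" using U assms(4) by (subst ln_le_cancel_iff) auto
    also have "\<dots> = ln (\<Prod>p\<in>U. real p)" by simp
    also have "\<dots> = (\<Sum>p\<in>U. ln (real p))"
    proof (rule ln_prod)
      fix p assume "p \<in> U"
      hence "real p > 1" using UQ p1 by auto
      thus "real p \<noteq> 0" by linarith
    qed (use fU[of U d] U in auto)
    finally show "ln X \<le> (\<Sum>p\<in>U. ln (real p))" .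
  qed
  also have "\<dots> \<le> (\<Sum>U\<in>G d. (\<Sum>p\<in>U. ln (real p)) * w U)"
  proof (rule sum_mono2[OF fin])
    fix U assume "U \<in> G d - {U\<in>G d. real (\<Prod>U) > X}"
    hence "U \<subseteq> Q" by (auto simp: G_def)
    hence "ln (real p) \<ge> 0" if "p \<in> U" for p
      using p1[of p] that by (intro ln_ge_zero) auto
    thus "0 \<le> (\<Sum>p\<in>U. ln (real p)) * w U"
      by (intro mult_nonneg_nonneg sum_nonneg w0)
  qed auto
  also have "\<dots> = (\<Sum>U\<in>G d. \<Sum>p\<in>Q. if p \<in> U then ln (real p) * w U else 0)"
  proof (rule sum.cong)
    fix U assume "U \<in> G d"
    hence "U \<subseteq> Q" by (auto simp: G_def)
    thus "(\<Sum>p\<in>U. ln (real p)) * w U = (\<Sum>p\<in>Q. if p \<in> U then ln (real p) * w U else 0)"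
      unfolding sum_distrib_right using assms(2) by (intro sum.mono_neutral_cong_left) auto
  qed auto
  also have "\<dots> = (\<Sum>p\<in>Q. \<Sum>U\<in>G d. if p \<in> U then ln (real p) * w U else 0)" by (rule sum.swap)
  \<comment> \<open>Removing p from U splits off the weight 1 / p and, by
    \<open>below_remove\<close>, costs one unit of the barrier. The map is injective on the sets
    that contain p, so the remaining sum is at most the whole sum at level d + 1.\<close>
  also have "\<dots> \<le> (\<Sum>p\<in>Q. ln (real p) / real p * (\<Sum>U\<in>G (d + 1). w U))"
  proof (rule sum_mono)
    fix p assume p: "p \<in> Q"
    have "(\<Sum>U\<in>G d. if p \<in> U then ln (real p) * w U else 0) = (\<Sum>U\<in>{U\<in>G d. p \<in> U}. ln (real p) * w U)"
      using fin by (simp add: sum.If_cases Int_def)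
    also have "\<dots> = (\<Sum>U\<in>{U\<in>G d. p \<in> U}. ln (real p) / real p * w (U - {p}))"
    proof (rule sum.cong)
      fix U assume U: "U \<in> {U\<in>G d. p \<in> U}"
      hence "w U = (1 / real p) * w (U - {p})"
        unfolding w_def using fU[of U d] by (intro prod.remove) auto
      thus "ln (real p) * w U = ln (real p) / real p * w (U - {p})" by simp
    qed auto
    also have "\<dots> = ln (real p) / real p * (\<Sum>V\<in>(\<lambda>U. U - {p}) ` {U\<in>G d. p \<in> U}. w V)"
    proof -
      have "inj_on (\<lambda>U. U - {p}) {U\<in>G d. p \<in> U}" by (rule inj_onI) (metis (no_types, lifting) insert_Diff mem_Collect_eq)
      thus ?thesis by (simp add: sum.reindex sum_distrib_left)
    qed
    also have "\<dots> \<le> ln (real p) / real p * (\<Sum>U\<in>G (d + 1). w U)"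
    proof (intro mult_left_mono sum_mono2 fin w0)
      show "(\<lambda>U. U - {p}) ` {U\<in>G d. p \<in> U} \<subseteq> G (d + 1)"
      proof (rule image_subsetI)
        fix U assume U: "U \<in> {U\<in>G d. p \<in> U}"
        have "below s r a b (d + 1) (U - {p})"
          using U fU[of U d] by (intro below_remove assms(1)) (auto simp: G_def)
        thus "U - {p} \<in> G (d + 1)" using U by (auto simp: G_def)
      qed
      show "0 \<le> ln (real p) / real p" using p1[OF p] by auto
    qed
    finally show "(\<Sum>U\<in>G d. if p \<in> U then ln (real p) * w U else 0) \<le> ln (real p) / real p * (\<Sum>U\<in>G (d + 1). w U)" .
  qed
  also have "\<dots> = (\<Sum>p\<in>Q. ln (real p) / real p) * (\<Sum>U\<in>G (d + 1). w U)" by (simp add: sum_distrib_right)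
  finally show ?thesis using lnX by (simp add: G_def field_simps)
qed

text \<open>The exponent \<open>\<delta> = 1/3840\<close> makes the Rankin tail, at most \<open>16 \<delta> * 12 d / sqrt L = d / (20 sqrt L)\<close>,
  half of the main term \<open>d / (10 sqrt L)\<close>.\<close>

lemma sum_below_small_ge:
  assumes T: "T \<ge> 2"
  defines "w \<equiv> \<lambda>p::nat. 1 / real p"
  shows "\<exists>c>0. \<exists>x0. \<forall>x\<ge>x0. \<forall>s d. \<bar>s\<bar> = 1 \<longrightarrow> 1 \<le> d \<longrightarrow> d \<le> sqrt (loglog x) + 1 \<longrightarrow>
     (let y = nat \<lfloor>x powr (1 / 3840)\<rfloor> in
       c * d * ln x / sqrt (loglog x) \<le>
       (\<Sum>U | U \<subseteq> {p. prime p \<and> Suc T \<le> p \<and> p < Suc y} \<and> below s (prime_prob w) (Suc T) (Suc y) d U \<and>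
          real (\<Prod>U) \<le> x powr (1 / 8). \<Prod>p\<in>U. w p))"
proof -
  define \<delta> :: real where "\<delta> = 1 / 3840"
  obtain M where M0: "M \<ge> 0" and M: "\<And>n. n \<ge> 2 \<Longrightarrow> \<bar>(\<Sum>p | prime p \<and> p \<le> n. 1 / real p) - ln (ln (real n))\<bar> \<le> M"
    using mertens_second by blast
  obtain C where C0: "C \<ge> 0" and C: "\<And>n. n \<ge> 1 \<Longrightarrow> \<bar>(\<Sum>p | prime p \<and> p \<le> n. ln (real p) / real p) - ln (real n)\<bar> \<le> C"
    using mertens_first by blast
  obtain c1 where c1: "c1 > 0" "\<And>n. n \<ge> T \<Longrightarrow> c1 * ln (real n) \<le> (\<Prod>p | prime p \<and> T < p \<and> p \<le> n. 1 + 1 / real p)"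
    using prod_primes_lower[OF T] by blast
  define K where "K = 2 * M + \<bar>ln (ln (real T))\<bar>"
  \<comment> \<open>K bounds the error in the sum of 1 / p over (T, y], Mertens' error entering at
    both ends. In K + 3, one unit comes from rounding x^\<delta> to y and two from the loss of
    variance in passing from 1 / p to the steps with probability 1 / (p + 1).\<close>
  have "eventually (\<lambda>x::real. x \<ge> 2) at_top"
       "eventually (\<lambda>x::real. ln (ln x) \<ge> 1) at_top"
       "eventually (\<lambda>x::real. ln (ln x) + K \<le> 4 * ln (ln x)) at_top"
       "eventually (\<lambda>x::real. ln (ln x) / 4 \<le> ln (\<delta> * ln x) - K - 3) at_top"
       "eventually (\<lambda>x::real. x powr \<delta> \<ge> real T + 1) at_top"
       "eventually (\<lambda>x::real. \<delta> * ln x \<ge> C) at_top"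
       "eventually (\<lambda>x::real. \<delta> / 2 * ln x \<le> ln (x powr \<delta> - 1)) at_top"
    unfolding \<delta>_def by real_asymp+
  hence "eventually (\<lambda>x::real. x \<ge> 2 \<and> ln (ln x) \<ge> 1 \<and> ln (ln x) + K \<le> 4 * ln (ln x) \<and>
      ln (ln x) / 4 \<le> ln (\<delta> * ln x) - K - 3 \<and> x powr \<delta> \<ge> real T + 1 \<and> \<delta> * ln x \<ge> C \<and>
      \<delta> / 2 * ln x \<le> ln (x powr \<delta> - 1)) at_top"
    by eventually_elim auto
  then obtain x0 :: real where x0: "\<And>x. x \<ge> x0 \<Longrightarrow> x \<ge> 2 \<and> ln (ln x) \<ge> 1 \<and> ln (ln x) + K \<le> 4 * ln (ln x) \<and>
      ln (ln x) / 4 \<le> ln (\<delta> * ln x) - K - 3 \<and> x powr \<delta> \<ge> real T + 1 \<and> \<delta> * ln x \<ge> C \<and>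
      \<delta> / 2 * ln x \<le> ln (x powr \<delta> - 1)"
    unfolding eventually_at_top_linorder by blast
  have w0: "w p \<ge> 0" for p by (simp add: w_def)
  have r: "prime_prob w p = 1 / (real p + 1)" if "prime p" for p
    using prime_gt_0_nat[OF that] that by (simp add: prime_prob_def w_def field_simps)
  have main: "c1 * \<delta> / 40 * d * ln x / sqrt (loglog x) \<le>
       (\<Sum>U | U \<subseteq> {p. prime p \<and> Suc T \<le> p \<and> p < Suc y} \<and> below s (prime_prob w) (Suc T) (Suc y) d U \<and>
          real (\<Prod>U) \<le> x powr (1 / 8). \<Prod>p\<in>U. w p)"
    if x: "x \<ge> x0" and s: "\<bar>s\<bar> = 1" and d: "1 \<le> d" "d \<le> sqrt (loglog x) + 1"
      and y: "y = nat \<lfloor>x powr \<delta>\<rfloor>" for x s d y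
  proof -
    define L where "L = ln (ln x)"
    define Q where "Q = {p. prime p \<and> Suc T \<le> p \<and> p < Suc y}"
    define W where "W = (\<lambda>d. \<Sum>U | U \<subseteq> Q \<and> below s (prime_prob w) (Suc T) (Suc y) d U. \<Prod>p\<in>U. w p)"
    define rs where "rs = map (prime_prob w) [Suc T..<Suc y]"
    define E where "E = (\<Prod>p\<in>Q. 1 + w p)"
    define X where "X = x powr (1 / 8)"
    have x2: "x \<ge> 2" and L: "L \<ge> 1" "L + K \<le> 4 * L" "L / 4 \<le> ln (\<delta> * ln x) - K - 3"
      and xd: "x powr \<delta> \<ge> real T + 1" "\<delta> * ln x \<ge> C" "\<delta> / 2 * ln x \<le> ln (x powr \<delta> - 1)"
      using x0[OF x] unfolding L_def by auto
    have lnx: "ln x > 0" using x2 by simp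
    have sL: "sqrt L \<ge> 1" "sqrt L > 0" using L by simp_all
    have xd2: "x powr \<delta> \<ge> 2" using xd T by linarith
    note yb = lnln_floor[OF xd2, folded y]
    have lnxd: "ln (x powr \<delta>) = \<delta> * ln x" using x2 by (simp add: ln_powr)
    have Ty: "T \<le> y" using xd yb by linarith
    have Q: "finite Q" "\<And>p. p \<in> Q \<Longrightarrow> prime p" "Q = {p. prime p \<and> T < p \<and> p \<le> y}"
      unfolding Q_def by auto
    have Q2: "Q \<subseteq> {2..}" using Q(2) by (auto dest: prime_ge_2_nat)
    have p2: "real p \<ge> 2" if "p \<in> Q" for p using Q2 that by force
    have rs: "set rs \<subseteq> {0..1}" unfolding rs_def by (rule prime_prob_bounds) (rule w0)
    have W: "W d = E * stay s rs d" for d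
      unfolding W_def Q_def E_def rs_def by (rule sum_below_weights) (use Ty w0 in auto)
    have lnlny: "ln (ln (real y)) \<le> L" "ln (ln (real y)) \<ge> ln (\<delta> * ln x) - 1"
    proof -
      have "x powr \<delta> \<le> x powr 1" using x2 by (intro powr_mono) (auto simp: \<delta>_def)
      hence "real y \<le> x" using yb x2 by simp
      thus "ln (ln (real y)) \<le> L" using yb(1) x2 by (simp add: L_def)
      show "ln (ln (real y)) \<ge> ln (\<delta> * ln x) - 1" using yb(5) unfolding lnxd by linarith
    qed
    have sumQ: "(\<Sum>p\<in>Q. 1 / real p) \<le> ln (ln (real y)) + K" "(\<Sum>p\<in>Q. 1 / real p) \<ge> ln (ln (real y)) - K"
      using M[OF yb(1)] M[OF T] sum_primes_interval[OF Ty, of "\<lambda>p. 1 / real p"] unfolding Q(3) K_def by linarith+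
    have var: "walk_var rs = (\<Sum>p\<in>Q. prime_prob w p * (1 - prime_prob w p))"
      unfolding rs_def walk_var_prime_prob Q_def ..
    have var_le: "walk_var rs \<le> 4 * L"
    proof -
      have "walk_var rs \<le> (\<Sum>p\<in>Q. 1 / real p)"
        unfolding var
      proof (rule sum_mono)
        fix p assume "p \<in> Q"
        thus "prime_prob w p * (1 - prime_prob w p) \<le> 1 / real p"
          using p2[of p] Q(2)[of p] by (simp add: r divide_simps) (simp add: algebra_simps)
      qed
      thus ?thesis using sumQ lnlny L by linarith
    qed
    have var_ge: "L / 4 \<le> walk_var rs"
    proof -
      have "L / 4 \<le> (\<Sum>p\<in>Q. 1 / real p) - 2 * (\<Sum>p\<in>Q. 1 / (real p * (real p - 1)))"
        using sumQ(2) lnlny L sum_telescope_inverse_le_1[OF Q(1) Q2] by linarith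
      also have "\<dots> = (\<Sum>p\<in>Q. 1 / real p - 2 / (real p * (real p - 1)))"
        by (simp add: sum_subtractf sum_distrib_left)
      also have "\<dots> \<le> walk_var rs"
        unfolding var
      proof (rule sum_mono)
        fix p assume pQ: "p \<in> Q"
        define z where "z = real p"
        have z: "z \<ge> 2" using p2[OF pQ] by (simp add: z_def)
        have "1 / z - 2 / (z * (z - 1)) \<le> 1 / z - 2 / (z * (z + 1))"
          using z by (intro diff_left_mono divide_left_mono mult_left_mono mult_pos_pos) auto
        also have "\<dots> = (z - 1) / (z * (z + 1))" using z by (simp add: divide_simps)
        also have "\<dots> \<le> z / ((z + 1) * (z + 1))"
          using z by (simp add: divide_simps) (simp add: algebra_simps)
        also have "\<dots> = prime_prob w p * (1 - prime_prob w p)"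
          using z Q(2)[OF pQ] by (simp add: r z_def[symmetric] divide_simps)
        finally show "1 / real p - 2 / (real p * (real p - 1)) \<le> prime_prob w p * (1 - prime_prob w p)"
          by (simp add: z_def)
      qed
      finally show ?thesis .
    qed
    have stay1: "stay s rs d \<ge> d / (10 * sqrt L)"
    proof -
      \<comment> \<open>\<open>stay_ge\<close> with D = 4 sqrt L, because \<open>walk_var rs\<close>
        is at most 4 L. The restriction of d to at most sqrt L + 1 ensures d \<le> D + 1.\<close>
      have "d / (2 * (4 * sqrt L + 1)) \<le> stay s rs d"
        using s rs var_le L sL d by (intro stay_ge) (auto simp: power_mult_distrib loglog_def L_def)
      moreover have "d / (10 * sqrt L) \<le> d / (2 * (4 * sqrt L + 1))"
        using sL d by (intro divide_left_mono mult_pos_pos add_pos_pos) simp_all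
      ultimately show ?thesis by linarith
    qed
    have stay2: "stay s rs (d + 1) \<le> 12 * d / sqrt L"
    proof -
      \<comment> \<open>Level d + 1 comes from the Rankin bound. The assumption d \<ge> 1 turns 4 (d
        + 2) into 12 d, so this matches the main term up to a constant.\<close>
      have "stay s rs (d + 1) \<le> 2 * (d + 1 + 1) / (sqrt L / 2)"
        using s rs var_ge L sL d by (intro stay_le) (auto simp: power_divide)
      also have "\<dots> = 4 * (d + 2) / sqrt L" by simp
      also have "\<dots> \<le> 12 * d / sqrt L" using d sL by (intro divide_right_mono) auto
      finally show ?thesis .
    qed
    have E: "E > 0" unfolding E_def using w0 by (intro prod_pos) (auto intro: add_pos_nonneg)
    have E_ge: "E \<ge> c1 * (\<delta> / 2 * ln x)"
    proof -
      have "ln (x powr \<delta> - 1) \<le> ln (real y)" using yb xd2 by (subst ln_le_cancel_iff) auto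
      hence "c1 * (\<delta> / 2 * ln x) \<le> c1 * ln (real y)" using xd c1 by (intro mult_left_mono) auto
      also have "\<dots> \<le> E" unfolding E_def Q(3) w_def by (rule c1(2)) (rule Ty)
      finally show ?thesis .
    qed
    have X: "X > 1" using x2 by (simp add: X_def)
    define R where "R = (\<Sum>U | U \<subseteq> Q \<and> below s (prime_prob w) (Suc T) (Suc y) d U \<and> real (\<Prod>U) > X. \<Prod>p\<in>U. w p)"
    define S where "S = (\<Sum>U | U \<subseteq> Q \<and> below s (prime_prob w) (Suc T) (Suc y) d U \<and> real (\<Prod>U) \<le> X. \<Prod>p\<in>U. w p)"
    have split: "W d = S + R"
    proof -
      have fin: "finite {U. U \<subseteq> Q \<and> P U}" for P
        by (rule finite_subset[of _ "Pow Q"]) (use Q(1) in auto)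
      have "{U. U \<subseteq> Q \<and> below s (prime_prob w) (Suc T) (Suc y) d U} =
         {U. U \<subseteq> Q \<and> below s (prime_prob w) (Suc T) (Suc y) d U \<and> real (\<Prod>U) \<le> X} \<union>
         {U. U \<subseteq> Q \<and> below s (prime_prob w) (Suc T) (Suc y) d U \<and> real (\<Prod>U) > X}" by auto
      thus ?thesis unfolding W_def S_def R_def
        by (simp only:) (intro sum.union_disjoint fin, auto)
    qed
    have "R \<le> (\<Sum>p\<in>Q. ln (real p) / real p) / ln X * W (d + 1)"
      unfolding R_def W_def w_def by (rule sum_below_large_le) (use s Q(1,2) X in simp_all)
    \<comment> \<open>The sum of ln p / p is at most ln y + C \<le> 2 \<delta> ln x, while ln X =
      (ln x) / 8. The ratio 16 \<delta> can be made small through \<delta> alone.\<close>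
    also have "\<dots> \<le> (16 * \<delta>) * W (d + 1)"
    proof (rule mult_right_mono)
      have "(\<Sum>p\<in>Q. ln (real p) / real p) \<le> (\<Sum>p | prime p \<and> p \<le> y. ln (real p) / real p)"
        unfolding Q(3) by (intro sum_mono2) (auto intro!: divide_nonneg_nonneg dest: prime_gt_0_nat)
      also have "\<dots> \<le> ln (real y) + C" using C[of y] yb(1) by simp
      also have "ln (real y) \<le> ln (x powr \<delta>)" using yb by (subst ln_le_cancel_iff) auto
      also have "ln (x powr \<delta>) + C \<le> 2 * \<delta> * ln x" using xd unfolding lnxd by linarith
      finally have "(\<Sum>p\<in>Q. ln (real p) / real p) \<le> 16 * \<delta> * ln X"
        using x2 by (simp add: X_def ln_powr)
      thus "(\<Sum>p\<in>Q. ln (real p) / real p) / ln X \<le> 16 * \<delta>"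
        using X by (simp add: divide_le_eq)
      show "0 \<le> W (d + 1)" unfolding W_def by (intro sum_nonneg prod_nonneg) (auto simp: w0)
    qed
    also have "\<dots> \<le> (16 * \<delta>) * (E * (12 * d / sqrt L))"
      unfolding W using E stay2 by (intro mult_left_mono) (auto simp: \<delta>_def)
    also have "\<dots> = E * (d / (20 * sqrt L))" by (simp add: \<delta>_def)
    finally have R: "R \<le> E * (d / (20 * sqrt L))" .
    have "E * (d / (10 * sqrt L)) \<le> W d" unfolding W using E stay1 by (intro mult_left_mono) auto
    moreover have "E * (d / (10 * sqrt L)) = 2 * (E * (d / (20 * sqrt L)))" by simp
    ultimately have "E * (d / (20 * sqrt L)) \<le> S" using R split by linarith
    moreover have "c1 * (\<delta> / 2 * ln x) * (d / (20 * sqrt L)) \<le> E * (d / (20 * sqrt L))"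
      using d sL by (intro mult_right_mono E_ge) auto
    moreover have "c1 * (\<delta> / 2 * ln x) * (d / (20 * sqrt L)) = c1 * \<delta> / 40 * d * ln x / sqrt (loglog x)"
      by (simp add: L_def loglog_def)
    ultimately show ?thesis unfolding S_def Q_def X_def by linarith
  qed
  show ?thesis
    using main c1(1) unfolding Let_def \<delta>_def[symmetric]
    by (intro exI[of _ "c1 * \<delta> / 40"] conjI exI[of _ x0]) (auto simp: \<delta>_def)
qed

section \<open>Products with a free large prime\<close>

lemma prime_factors_prod_primes:
  assumes "finite U" "\<And>p. p \<in> U \<Longrightarrow> prime (p :: nat)"
  shows "prime_factors (\<Prod>U) = U"
proof -
  have "prime_factorization (\<Prod>U) = (\<Sum>p\<in>U. prime_factorization p)"
    using assms prime_gt_0_nat by (intro prime_factorization_prod) blast+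
  also have "\<dots> = (\<Sum>p\<in>U. {#p#})"
    using assms(2) by (intro sum.cong) (auto simp: prime_factorization_prime)
  finally have "prime_factors (\<Prod>U) = set_mset (\<Sum>p\<in>U. {#p#})" by simp
  also have "\<dots> = U" using assms(1) by (simp add: set_mset_sum)
  finally show ?thesis .
qed

text \<open>Since P and the product of U are at most x^(1/8), the prime q may range up to z \<ge>
  x^(3/4). At least z / (4 ln x) primes lie below z, and discarding those up to sqrt x costs at most
  half of that. Products are distinct: q is the only prime factor above sqrt x, and U is recovered
  from the cofactor, P being fixed.\<close>

lemma card_products_ge:
  fixes P :: nat
  assumes "P \<ge> 1"
  shows "\<exists>x0. \<forall>x\<ge>x0. \<forall>F A. finite A \<longrightarrow> finite F \<longrightarrow>
     (\<forall>U\<in>F. finite U \<and> (\<forall>p\<in>U. prime p \<and> real p \<le> sqrt x) \<and> real (\<Prod>U) \<le> x powr (1 / 8)) \<longrightarrow>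
     (\<forall>U\<in>F. \<forall>q. prime q \<longrightarrow> sqrt x < real q \<longrightarrow> real (P * \<Prod>U * q) \<le> x \<longrightarrow> P * \<Prod>U * q \<in> A) \<longrightarrow>
     x / (8 * real P * ln x) * (\<Sum>U\<in>F. \<Prod>p\<in>U. 1 / real p) \<le> real (card A)"
proof -
  obtain z0 where z0: "\<And>z. z \<ge> z0 \<Longrightarrow> z / (4 * ln z) \<le> real (card {p. prime p \<and> real p \<le> z})"
    using card_primes_lower_bound by blast
  have "eventually (\<lambda>x::real. x \<ge> 2) at_top"
       "eventually (\<lambda>x::real. x powr (1 / 8) \<ge> real P) at_top"
       "eventually (\<lambda>x::real. x powr (3 / 4) \<ge> \<bar>z0\<bar> + 2) at_top"
       "eventually (\<lambda>x::real. sqrt x \<le> x powr (3 / 4) / (8 * ln x)) at_top"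
       "eventually (\<lambda>x::real. sqrt x \<ge> real P) at_top"
    by real_asymp+
  hence "eventually (\<lambda>x::real. x \<ge> 2 \<and> x powr (1 / 8) \<ge> real P \<and> x powr (3 / 4) \<ge> \<bar>z0\<bar> + 2 \<and>
      sqrt x \<le> x powr (3 / 4) / (8 * ln x) \<and> sqrt x \<ge> real P) at_top"
    by eventually_elim auto
  then obtain x0 :: real where x0: "\<And>x. x \<ge> x0 \<Longrightarrow> x \<ge> 2 \<and> x powr (1 / 8) \<ge> real P \<and> x powr (3 / 4) \<ge> \<bar>z0\<bar> + 2 \<and>
      sqrt x \<le> x powr (3 / 4) / (8 * ln x) \<and> sqrt x \<ge> real P"
    unfolding eventually_at_top_linorder by blast
  have main: "x / (8 * real P * ln x) * (\<Sum>U\<in>F. \<Prod>p\<in>U. 1 / real p) \<le> real (card A)"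
    if x: "x \<ge> x0" and fA: "finite A" "finite F"
      and F: "\<And>U. U \<in> F \<Longrightarrow> finite U" "\<And>U p. U \<in> F \<Longrightarrow> p \<in> U \<Longrightarrow> prime p"
        "\<And>U p. U \<in> F \<Longrightarrow> p \<in> U \<Longrightarrow> real p \<le> sqrt x" "\<And>U. U \<in> F \<Longrightarrow> real (\<Prod>U) \<le> x powr (1 / 8)"
      and A: "\<And>U q. U \<in> F \<Longrightarrow> prime q \<Longrightarrow> sqrt x < real q \<Longrightarrow> real (P * \<Prod>U * q) \<le> x \<Longrightarrow> P * \<Prod>U * q \<in> A"
    for x F and A :: "nat set"
  proof -
    have x2: "x \<ge> 2" "x powr (1 / 8) \<ge> real P" "x powr (3 / 4) \<ge> \<bar>z0\<bar> + 2"
      "sqrt x \<le> x powr (3 / 4) / (8 * ln x)" "sqrt x \<ge> real P" using x0[OF x] by auto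
    have lnx: "ln x > 0" using x2 by simp
    define z where "z = (\<lambda>U. x / (real P * real (\<Prod>U)))"
    define q_set where "q_set = (\<lambda>U. {q. prime q \<and> sqrt x < real q \<and> real q \<le> z U})"
    define h where "h = (\<lambda>(U, q). P * \<Prod>U * q)"
    have fin_le: "finite {q. prime q \<and> real q \<le> t}" for t
      by (rule finite_subset[of _ "{..nat \<lfloor>t\<rfloor>}"]) (auto simp: le_nat_floor)
    have fin_q: "finite (q_set U)" for U
      unfolding q_set_def by (rule finite_subset[OF _ fin_le[of "z U"]]) auto
    have prod_pos: "\<Prod>U \<ge> 1" if "U \<in> F" for U
      using F(2)[OF that] by (intro prod_ge_1) (auto simp: Suc_le_eq dest: prime_gt_0_nat)
    have qz: "real (P * \<Prod>U * q) \<le> x" if "U \<in> F" "q \<in> q_set U" for U q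
    proof -
      have "real q \<le> x / (real P * real (\<Prod>U))" using that by (simp add: q_set_def z_def)
      moreover have "real P * real (\<Prod>U) > 0"
        using prod_pos[OF that(1)] assms by (intro mult_pos_pos) (auto simp del: of_nat_prod)
      ultimately have "real q * (real P * real (\<Prod>U)) \<le> x" by (simp only: pos_le_divide_eq)
      thus ?thesis by (simp add: mult_ac)
    qed
    have pf: "q' = q" if q: "prime q" "sqrt x < real q" and q': "prime q'" "sqrt x < real q'"
        and dvd: "q' dvd P * \<Prod>U * q" and U: "U \<in> F" for q q' U
    proof -
      have "\<not> q' dvd P"
      proof
        assume "q' dvd P"
        hence "q' \<le> P" using assms by (intro dvd_imp_le) auto
        thus False using q' x2 by linarith
      qed
      moreover have "\<not> q' dvd \<Prod>U"
      proof
        assume "q' dvd \<Prod>U"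
        then obtain p where "p \<in> U" "q' dvd p"
          using prime_dvd_prod_iff[OF F(1)[OF U], of q' "\<lambda>p. p"] q' by auto
        hence "q' = p" using F(2)[OF U] q' primes_dvd_imp_eq by blast
        thus False using F(3)[OF U \<open>p \<in> U\<close>] q' by linarith
      qed
      ultimately have "q' dvd q" using dvd q' by (auto simp: prime_dvd_mult_iff)
      thus ?thesis using q q' primes_dvd_imp_eq by blast
    qed
    have "inj_on h (Sigma F q_set)"
    proof (rule inj_onI)
      fix a b assume ab: "a \<in> Sigma F q_set" "b \<in> Sigma F q_set" "h a = h b"
      obtain U q where a: "a = (U, q)" "U \<in> F" "q \<in> q_set U" using ab(1) by auto
      obtain V q' where b: "b = (V, q')" "V \<in> F" "q' \<in> q_set V" using ab(2) by auto
      have eq: "P * \<Prod>U * q = P * \<Prod>V * q'" using ab(3) a b by (simp add: h_def)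
      have "q' dvd P * \<Prod>U * q" unfolding eq by simp
      hence qq: "q' = q" using a b by (intro pf[of q q' U]) (auto simp: q_set_def)
      have "q > 0" using a prime_gt_0_nat by (auto simp: q_set_def)
      hence pr: "\<Prod>U = \<Prod>V" using eq assms unfolding qq by simp
      have "U = prime_factors (\<Prod>U)" if "U \<in> F" for U
        using F(1,2)[OF that] by (simp add: prime_factors_prod_primes)
      hence "U = V" using a b pr by metis
      thus "a = b" using a b qq by simp
    qed
    hence "card (Sigma F q_set) = card (h ` Sigma F q_set)" by (simp add: card_image)
    also have "\<dots> \<le> card A"
    proof (rule card_mono[OF fA(1)], clarify)
      fix U q assume "U \<in> F" "q \<in> q_set U"
      thus "h (U, q) \<in> A" using A[of U q] qz[of U q] by (auto simp: h_def q_set_def)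
    qed
    finally have le: "real (card (Sigma F q_set)) \<le> real (card A)" by simp
    have "card (Sigma F q_set) = (\<Sum>U\<in>F. card (q_set U))"
      using fA(2) fin_q by (intro card_SigmaI) auto
    hence "(\<Sum>U\<in>F. real (card (q_set U))) \<le> real (card A)" using le by simp
    moreover have "x / (8 * real P * ln x) * (\<Sum>U\<in>F. \<Prod>p\<in>U. 1 / real p) \<le> (\<Sum>U\<in>F. real (card (q_set U)))"
      unfolding sum_distrib_left
    proof (rule sum_mono)
      fix U assume U: "U \<in> F"
      have PU: "real P * real (\<Prod>U) \<ge> 1"
      proof -
        have "1 * 1 \<le> P * \<Prod>U" using prod_pos[OF U] assms by (intro mult_mono) auto
        hence "real (1 * 1) \<le> real (P * \<Prod>U)" by (simp only: of_nat_le_iff)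
        thus ?thesis by (simp only: of_nat_mult of_nat_1 mult_1)
      qed
      define m where "m = real (\<Prod>U)"
      have m: "m \<ge> 0" "m \<le> x powr (1 / 8)" "real P * m \<ge> 1" "z U = x / (real P * m)"
        unfolding m_def z_def by (rule of_nat_0_le_iff F(4)[OF U] PU refl)+
      have mp: "m > 0" using m(1,3) by (cases "m = 0") auto
      have "real P * m \<le> x powr (1 / 8) * x powr (1 / 8)"
        using x2 m by (intro mult_mono) auto
      also have "\<dots> = x powr (1 / 4)" by (simp flip: powr_add)
      finally have "x / x powr (1 / 4) \<le> z U"
        unfolding m(4) using mp x2 assms by (intro divide_left_mono mult_pos_pos) auto
      moreover have "x / x powr (1 / 4) = x powr (3 / 4)"
        using x2 powr_diff[of x 1 "1 / 4"] by simp
      ultimately have zU: "x powr (3 / 4) \<le> z U" by simp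
      have "x * 1 \<le> x * (real P * m)" using m(3) x2 by (intro mult_left_mono) auto
      hence zx: "z U \<le> x" unfolding m(4) using m(3) by (simp add: divide_le_eq)
      have z2: "z U \<ge> 2" "z U \<ge> z0" using zU x2 by linarith+
      have "z U / (4 * ln x) \<le> z U / (4 * ln (z U))"
        using z2 zx by (intro divide_left_mono mult_left_mono mult_pos_pos) auto
      also have "\<dots> \<le> real (card {p. prime p \<and> real p \<le> z U})" by (rule z0) fact
      also have "\<dots> \<le> real (card (q_set U)) + z U / (8 * ln x)"
      proof -
        have "{p. prime p \<and> real p \<le> z U} \<subseteq> q_set U \<union> {1..nat \<lfloor>sqrt x\<rfloor>}"
        proof
          fix p assume p: "p \<in> {p. prime p \<and> real p \<le> z U}"
          show "p \<in> q_set U \<union> {1..nat \<lfloor>sqrt x\<rfloor>}"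
          proof (cases "real p \<le> sqrt x")
            case True
            hence "p \<le> nat \<lfloor>sqrt x\<rfloor>" by (rule le_nat_floor)
            thus ?thesis using p prime_ge_1_nat by auto
          qed (use p in \<open>auto simp: q_set_def\<close>)
        qed
        hence "card {p. prime p \<and> real p \<le> z U} \<le> card (q_set U \<union> {1..nat \<lfloor>sqrt x\<rfloor>})"
          using fin_q by (intro card_mono) auto
        also have "\<dots> \<le> card (q_set U) + nat \<lfloor>sqrt x\<rfloor>"
          using card_Un_le[of "q_set U" "{1..nat \<lfloor>sqrt x\<rfloor>}"] by simp
        finally have "real (card {p. prime p \<and> real p \<le> z U}) \<le> real (card (q_set U)) + real (nat \<lfloor>sqrt x\<rfloor>)"
          by linarith
        moreover have "real (nat \<lfloor>sqrt x\<rfloor>) \<le> sqrt x" using x2 by simp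
        moreover have "x powr (3 / 4) / (8 * ln x) \<le> z U / (8 * ln x)"
          using zU lnx by (intro divide_right_mono) auto
        ultimately show ?thesis using x2 by linarith
      qed
      finally have "z U / (4 * ln x) - z U / (8 * ln x) \<le> real (card (q_set U))" by linarith
      moreover have "z U / (4 * ln x) - z U / (8 * ln x) = z U / (8 * ln x)" using lnx by (simp add: field_simps)
      moreover have "x / (8 * real P * ln x) * (\<Prod>p\<in>U. 1 / real p) = z U / (8 * ln x)"
        by (simp add: z_def prod_dividef)
      ultimately show "x / (8 * real P * ln x) * (\<Prod>p\<in>U. 1 / real p) \<le> real (card (q_set U))" by simp
    qed
    ultimately show ?thesis by linarith
  qed
  show ?thesis
  proof (intro exI[of _ x0] allI impI)
    fix x :: real and F :: "nat set set" and A :: "nat set"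
    assume x: "x \<ge> x0" and fA: "finite A" and fF: "finite F"
      and F: "\<forall>U\<in>F. finite U \<and> (\<forall>p\<in>U. prime p \<and> real p \<le> sqrt x) \<and> real (\<Prod>U) \<le> x powr (1 / 8)"
      and A: "\<forall>U\<in>F. \<forall>q. prime q \<longrightarrow> sqrt x < real q \<longrightarrow> real (P * \<Prod>U * q) \<le> x \<longrightarrow> P * \<Prod>U * q \<in> A"
    show "x / (8 * real P * ln x) * (\<Sum>U\<in>F. \<Prod>p\<in>U. 1 / real p) \<le> real (card A)"
      by (rule main[OF x fA fF]) (use F A in blast)+
  qed
qed

text \<open>Leaving A and the prescribed set V open lets both barriers use the same count; it
  remains to check that every admissible product lies in A. The ln x of the walk's total mass
  cancels the 1 / ln x from the density of the primes q.\<close>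

lemma card_ge_of_below:
  assumes T: "T \<ge> 2" and V: "finite V" "\<And>p. p \<in> V \<Longrightarrow> prime (p :: nat)"
  shows "\<exists>c>0. \<exists>x0. \<forall>x\<ge>x0. \<forall>s d A. \<bar>s\<bar> = 1 \<longrightarrow> 1 \<le> d \<longrightarrow> d \<le> sqrt (loglog x) + 1 \<longrightarrow> finite A \<longrightarrow>
     (\<forall>U q. (\<forall>p\<in>U. prime p \<and> T < p \<and> p \<le> nat \<lfloor>x powr (1 / 3840)\<rfloor>) \<longrightarrow>
        below s (prime_prob (\<lambda>p. 1 / real p)) (Suc T) (Suc (nat \<lfloor>x powr (1 / 3840)\<rfloor>)) d U \<longrightarrow>
        prime q \<longrightarrow> sqrt x < real q \<longrightarrow> real (\<Prod>V * \<Prod>U * q) \<le> x \<longrightarrow> \<Prod>V * \<Prod>U * q \<in> A) \<longrightarrow>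
     c * (d * x / sqrt (loglog x)) \<le> real (card A)"
proof -
  define P where "P = \<Prod>V"
  have P: "P \<ge> 1" unfolding P_def using V by (intro prod_ge_1) (auto simp: Suc_le_eq prime_gt_0_nat)
  define w where "w = (\<lambda>p. 1 / real p)"
  define G where "G = (\<lambda>x s d. {U. U \<subseteq> {p. prime p \<and> Suc T \<le> p \<and> p < Suc (nat \<lfloor>x powr (1 / 3840)\<rfloor>)} \<and>
      below s (prime_prob w) (Suc T) (Suc (nat \<lfloor>x powr (1 / 3840)\<rfloor>)) d U \<and> real (\<Prod>U) \<le> x powr (1 / 8)})"
  obtain c x1 where c: "c > 0" and bd: "\<And>x s d. x \<ge> x1 \<Longrightarrow> \<bar>s\<bar> = 1 \<Longrightarrow> 1 \<le> d \<Longrightarrow> d \<le> sqrt (loglog x) + 1 \<Longrightarrow>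
      c * d * ln x / sqrt (loglog x) \<le> (\<Sum>U\<in>G x s d. \<Prod>p\<in>U. w p)"
    using sum_below_small_ge[OF T] unfolding G_def w_def Let_def by blast
  obtain x2 where x2: "\<And>x F A. x \<ge> x2 \<Longrightarrow> finite A \<Longrightarrow> finite F \<Longrightarrow>
     \<forall>U\<in>F. finite U \<and> (\<forall>p\<in>U. prime p \<and> real p \<le> sqrt x) \<and> real (\<Prod>U) \<le> x powr (1 / 8) \<Longrightarrow>
     \<forall>U\<in>F. \<forall>q. prime q \<longrightarrow> sqrt x < real q \<longrightarrow> real (P * \<Prod>U * q) \<le> x \<longrightarrow> P * \<Prod>U * q \<in> A \<Longrightarrow>
     x / (8 * real P * ln x) * (\<Sum>U\<in>F. \<Prod>p\<in>U. 1 / real p) \<le> real (card A)"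
    using card_products_ge[OF P] by metis
  have main: "c / (8 * real P) * (d * x / sqrt (loglog x)) \<le> real (card A)"
    if x: "x \<ge> max 2 (max x1 x2)" and s: "\<bar>s\<bar> = 1" and d: "1 \<le> d" "d \<le> sqrt (loglog x) + 1" and fA: "finite A"
      and A: "\<forall>U q. (\<forall>p\<in>U. prime p \<and> T < p \<and> p \<le> nat \<lfloor>x powr (1 / 3840)\<rfloor>) \<longrightarrow>
        below s (prime_prob w) (Suc T) (Suc (nat \<lfloor>x powr (1 / 3840)\<rfloor>)) d U \<longrightarrow>
        prime q \<longrightarrow> sqrt x < real q \<longrightarrow> real (P * \<Prod>U * q) \<le> x \<longrightarrow> P * \<Prod>U * q \<in> A" for x s d A
  proof -
    define y where "y = nat \<lfloor>x powr (1 / 3840)\<rfloor>"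
    have lnx: "ln x > 0" using x by simp
    have "x powr (1 / 3840) \<le> x powr (1 / 2)" using x by (intro powr_mono) auto
    hence "x powr (1 / 3840) \<le> sqrt x" using x by (simp add: powr_half_sqrt)
    moreover have "real y \<le> x powr (1 / 3840)" by (simp add: y_def)
    ultimately have y: "real y \<le> sqrt x" by linarith
    have small: "finite U" "\<forall>p\<in>U. prime p \<and> T < p \<and> p \<le> y" if "U \<in> G x s d" for U
    proof -
      have U: "U \<subseteq> {p. prime p \<and> Suc T \<le> p \<and> p < Suc y}" using that by (simp add: G_def y_def)
      hence "U \<subseteq> {..y}" by auto
      thus "finite U" by (rule finite_subset) simp
      show "\<forall>p\<in>U. prime p \<and> T < p \<and> p \<le> y" using U by auto
    qed
    have fG: "finite (G x s d)"
      by (rule finite_subset[of _ "Pow {..y}"]) (auto simp: G_def y_def[symmetric])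
    have "c / (8 * real P) * (d * x / sqrt (loglog x)) = x / (8 * real P * ln x) * (c * d * ln x / sqrt (loglog x))"
      using lnx P by (simp add: field_simps)
    also have "\<dots> \<le> x / (8 * real P * ln x) * (\<Sum>U\<in>G x s d. \<Prod>p\<in>U. w p)"
      using x lnx P s d by (intro mult_left_mono bd) auto
    also have "\<dots> \<le> real (card A)"
      unfolding w_def
    proof (rule x2[OF _ fA fG])
      show "\<forall>U\<in>G x s d. finite U \<and> (\<forall>p\<in>U. prime p \<and> real p \<le> sqrt x) \<and> real (\<Prod>U) \<le> x powr (1 / 8)"
      proof
        fix U assume U: "U \<in> G x s d"
        have "prime p \<and> real p \<le> sqrt x" if "p \<in> U" for p
        proof -
          have "prime p" "p \<le> y" using small(2)[OF U] that by auto
          thus ?thesis using y by (simp add: order_trans[of "real p" "real y"])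
        qed
        moreover have "real (\<Prod>U) \<le> x powr (1 / 8)" using U unfolding G_def by blast
        ultimately show "finite U \<and> (\<forall>p\<in>U. prime p \<and> real p \<le> sqrt x) \<and> real (\<Prod>U) \<le> x powr (1 / 8)"
          using small(1)[OF U] by blast
      qed
      show "\<forall>U\<in>G x s d. \<forall>q. prime q \<longrightarrow> sqrt x < real q \<longrightarrow> real (P * \<Prod>U * q) \<le> x \<longrightarrow> P * \<Prod>U * q \<in> A"
      proof
        fix U assume U: "U \<in> G x s d"
        have "below s (prime_prob w) (Suc T) (Suc (nat \<lfloor>x powr (1 / 3840)\<rfloor>)) d U" using U unfolding G_def by blast
        thus "\<forall>q. prime q \<longrightarrow> sqrt x < real q \<longrightarrow> real (P * \<Prod>U * q) \<le> x \<longrightarrow> P * \<Prod>U * q \<in> A"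
          using A small(2)[OF U] unfolding y_def by blast
      qed
    qed (use x in auto)
    finally show ?thesis .
  qed
  show ?thesis
    unfolding P_def[symmetric] w_def[symmetric]
  proof (rule exI[of _ "c / (8 * real P)"], rule conjI)
    show "c / (8 * real P) > 0" using c P by simp
  qed (rule exI[of _ "max 2 (max x1 x2)"], use main in blast)
qed

section \<open>Checking the barriers for the constructed integers\<close>

lemma omega_product:
  assumes "finite V" "finite U" "\<And>p. p \<in> V \<Longrightarrow> prime p" "\<And>p. p \<in> U \<Longrightarrow> prime p" "prime q"
    and "V \<inter> U = {}" "q \<notin> V \<union> U"
  shows "omega (\<Prod>V * \<Prod>U * q) t =
     card {p\<in>V. real p \<le> t} + card {p\<in>U. real p \<le> t} + (if real q \<le> t then 1 else 0)"
proof -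
  have nz: "\<Prod>V \<noteq> 0" "\<Prod>U \<noteq> 0" "q \<noteq> 0" using assms by (auto dest: prime_gt_0_nat)
  hence "prime_factors (\<Prod>V * \<Prod>U * q) = V \<union> U \<union> {q}"
    using assms by (simp add: prime_factors_product prime_factors_prod_primes prime_prime_factors)
  hence "omega (\<Prod>V * \<Prod>U * q) t = card (({p\<in>V. real p \<le> t} \<union> {p\<in>U. real p \<le> t}) \<union> {p\<in>{q}. real p \<le> t})"
    unfolding omega_def by (auto intro!: arg_cong[of _ _ card])
  also have "\<dots> = card ({p\<in>V. real p \<le> t} \<union> {p\<in>U. real p \<le> t}) + card {p\<in>{q}. real p \<le> t}"
    using assms by (intro card_Un_disjoint) auto
  also have "card ({p\<in>V. real p \<le> t} \<union> {p\<in>U. real p \<le> t}) = card {p\<in>V. real p \<le> t} + card {p\<in>U. real p \<le> t}"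
    using assms by (intro card_Un_disjoint) auto
  also have "card {p\<in>{q}. real p \<le> t} = (if real q \<le> t then 1 else 0)"
    by (cases "real q \<le> t") (auto simp: Collect_conv_if)
  finally show ?thesis .
qed

text \<open>The point is that K does not depend on T: afterwards T can be chosen large in terms of
  K.\<close>

lemma drift_bounds:
  "\<exists>K\<ge>0. \<forall>T j. 2 \<le> T \<longrightarrow> T \<le> j \<longrightarrow>
     \<bar>(\<Sum>i\<in>{Suc T..<Suc j}. prime_prob (\<lambda>p. 1 / real p) i) - (ln (ln (real j)) - ln (ln (real T)))\<bar> \<le> K"
proof -
  obtain M where M0: "M \<ge> 0" and M: "\<And>n. n \<ge> 2 \<Longrightarrow> \<bar>(\<Sum>p | prime p \<and> p \<le> n. 1 / real p) - ln (ln (real n))\<bar> \<le> M"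
    using mertens_second by blast
  have main: "\<bar>(\<Sum>i\<in>{Suc T..<Suc j}. prime_prob (\<lambda>p. 1 / real p) i) - (ln (ln (real j)) - ln (ln (real T)))\<bar> \<le> 2 * M + 1"
    if T: "2 \<le> T" and j: "T \<le> j" for T j
  proof -
    define Q where "Q = {p. prime p \<and> T < p \<and> p \<le> j}"
    have Q: "finite Q" "Q \<subseteq> {2..}" unfolding Q_def by (auto dest: prime_ge_2_nat)
    have "{p. prime p \<and> Suc T \<le> p \<and> p < Suc j} = Q" by (auto simp: Q_def)
    hence eq: "(\<Sum>i\<in>{Suc T..<Suc j}. prime_prob (\<lambda>p. 1 / real p) i) = (\<Sum>p\<in>Q. 1 / (real p + 1))"
      unfolding sum_prime_prob
      by (intro sum.cong) (auto simp: prime_prob_def Q_def field_simps dest!: prime_gt_0_nat)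
    have le: "(\<Sum>p\<in>Q. 1 / (real p + 1)) \<le> (\<Sum>p\<in>Q. 1 / real p)"
      using Q by (intro sum_mono divide_left_mono) auto
    have "(\<Sum>p\<in>Q. 1 / real p) - (\<Sum>p\<in>Q. 1 / (real p * (real p - 1))) = (\<Sum>p\<in>Q. 1 / real p - 1 / (real p * (real p - 1)))"
      by (simp add: sum_subtractf)
    also have "\<dots> \<le> (\<Sum>p\<in>Q. 1 / (real p + 1))"
    proof (rule sum_mono)
      fix p assume "p \<in> Q"
      hence "p \<ge> 2" using Q by auto
      hence p: "real p \<ge> 2" by simp
      have "1 / (real p * (real p + 1)) \<le> 1 / (real p * (real p - 1))"
        using p by (intro divide_left_mono mult_left_mono mult_pos_pos) auto
      moreover have "1 / real p - 1 / (real p * (real p + 1)) = 1 / (real p + 1)"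
        using p by (simp add: divide_simps)
      ultimately show "1 / real p - 1 / (real p * (real p - 1)) \<le> 1 / (real p + 1)" by linarith
    qed
    finally have "(\<Sum>p\<in>Q. 1 / real p) - 1 \<le> (\<Sum>p\<in>Q. 1 / (real p + 1))"
      using sum_telescope_inverse_le_1[OF Q] by linarith
    moreover have "\<bar>(\<Sum>p\<in>Q. 1 / real p) - (ln (ln (real j)) - ln (ln (real T)))\<bar> \<le> 2 * M"
      using M[of T] M[of j] T j sum_primes_interval[OF j, of "\<lambda>p. 1 / real p"] unfolding Q_def by linarith
    ultimately show ?thesis using le unfolding eq by linarith
  qed
  show ?thesis by (rule exI[of _ "2 * M + 1"]) (use main M0 in auto)
qed

text \<open>An integer divisible by all primes up to t meets the lower barrier at t even for \<beta>
  = 0. Both ln (ln t) \<le> ln t - 1 and \<open>card_primes_ge_ln\<close> lose the same constant 1,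
  so no error is left.\<close>

lemma card_primes_ge_lnln:
  assumes "t \<ge> (2 :: real)"
  shows "loglog t \<le> real (card {p. prime p \<and> real p \<le> t})"
proof -
  define n where "n = nat \<lfloor>t\<rfloor>"
  note n = lnln_floor[OF assms, folded n_def]
  have "ln (ln t) \<le> ln t - 1" using assms by (intro ln_le_minus_one) simp
  also have "ln t \<le> ln (real (Suc n))" using n assms by (subst ln_le_cancel_iff) auto
  also have "\<dots> \<le> real (card {p. prime p \<and> p \<le> n}) + 1" by (rule card_primes_ge_ln)
  also have "{p. prime p \<and> p \<le> n} = {p. prime p \<and> real p \<le> t}"
    using n by (auto simp: n_def intro: le_nat_floor)
  finally show ?thesis by (simp add: loglog_def)
qed

lemma card_prefix:
  assumes "\<And>p. p \<in> U \<Longrightarrow> T < p \<and> p \<le> y" "t \<ge> 0"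
  shows "card {p\<in>U. real p \<le> t} = card (U \<inter> {Suc T..<Suc (min (nat \<lfloor>t\<rfloor>) y)})"
proof -
  have "real p \<le> t \<longleftrightarrow> p \<le> nat \<lfloor>t\<rfloor>" for p using assms(2) by (auto simp: le_nat_floor le_nat_iff le_floor_iff)
  thus ?thesis using assms(1) by (intro arg_cong[of _ _ card]) (auto simp: less_Suc_eq_le Suc_le_eq)
qed

text \<open>The walk runs at level d = \<beta> + 1, which is at least 1 as the earlier estimates
  require. V is empty for the upper barrier and consists of all primes up to T for the lower
  one.\<close>

lemma card_barrier_sets_ge:
  "\<exists>c>0. \<exists>x0. \<forall>x\<ge>x0. \<forall>\<beta>. 0 \<le> \<beta> \<longrightarrow> \<beta> \<le> sqrt (loglog x) \<longrightarrow>
     c * ((\<beta> + 1) * x / sqrt (loglog x)) \<le> real (card (upper_barrier_set x \<beta>)) \<and>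
     c * ((\<beta> + 1) * x / sqrt (loglog x)) \<le> real (card (lower_barrier_set x \<beta>))"
proof -
  define \<delta> :: real where "\<delta> = 1 / 3840"
  define w where "w = (\<lambda>p. 1 / real p)"
  obtain K where K0: "K \<ge> 0" and K: "\<And>T j. 2 \<le> T \<Longrightarrow> T \<le> j \<Longrightarrow>
     \<bar>(\<Sum>i\<in>{Suc T..<Suc j}. prime_prob w i) - (ln (ln (real j)) - ln (ln (real T)))\<bar> \<le> K"
    using drift_bounds unfolding w_def by blast
  \<comment> \<open>The second condition serves the upper barrier: ln (ln T) pays for the drift
    error K, the excess of d over \<beta>, and the prime q. The third serves the lower barrier
    through \<open>card_primes_ge_ln\<close>.\<close>
  have "eventually (\<lambda>t::real. t \<ge> 2) at_top"
       "eventually (\<lambda>t::real. ln (ln t) \<ge> K + 2) at_top"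
       "eventually (\<lambda>t::real. ln t - 1 - ln (ln t) \<ge> K + 2 - ln \<delta>) at_top"
    by real_asymp+
  hence "eventually (\<lambda>t::real. t \<ge> 2 \<and> ln (ln t) \<ge> K + 2 \<and> ln t - 1 - ln (ln t) \<ge> K + 2 - ln \<delta>) at_top"
    by eventually_elim auto
  then obtain t0 :: real where t0: "\<And>t. t \<ge> t0 \<Longrightarrow> t \<ge> 2 \<and> ln (ln t) \<ge> K + 2 \<and> ln t - 1 - ln (ln t) \<ge> K + 2 - ln \<delta>"
    unfolding eventually_at_top_linorder by blast
  define T where "T = nat \<lceil>t0\<rceil>"
  have "real T \<ge> t0" unfolding T_def by (rule real_nat_ceiling_ge)
  hence T: "T \<ge> 2" "ln (ln (real T)) \<ge> K + 2" "ln (real T) - 1 - ln (ln (real T)) \<ge> K + 2 - ln \<delta>"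
    using t0[of "real T"] by auto
  define V where "V = {p. prime p \<and> p \<le> T}"
  have V: "finite V" "\<And>p. p \<in> V \<Longrightarrow> prime p" unfolding V_def by auto
  \<comment> \<open>The head start covers the part ln (ln T) of the clock that elapses before the
    walk starts, the drift error K, the excess of d over \<beta>, one unit for rounding, and -ln
    \<delta> for the range beyond x^\<delta>.\<close>
  have cardV: "real (card V) \<ge> ln (ln (real T)) + K + 2 - ln \<delta>"
  proof -
    have "ln (real T) \<le> ln (real (Suc T))" using T(1) by simp
    thus ?thesis using card_primes_ge_ln[of T] T(3) unfolding V_def by linarith
  qed
  define Y where "Y = (\<lambda>x::real. nat \<lfloor>x powr (1 / 3840)\<rfloor>)"
  obtain c1 x1 where c1: "c1 > 0" and bd1: "\<And>x s d A. x \<ge> x1 \<Longrightarrow> \<bar>s\<bar> = 1 \<Longrightarrow> 1 \<le> d \<Longrightarrow> d \<le> sqrt (loglog x) + 1 \<Longrightarrow>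
      finite A \<Longrightarrow> (\<forall>U q. (\<forall>p\<in>U. prime p \<and> T < p \<and> p \<le> Y x) \<longrightarrow> below s (prime_prob w) (Suc T) (Suc (Y x)) d U \<longrightarrow>
        prime q \<longrightarrow> sqrt x < real q \<longrightarrow> real (\<Prod>{} * \<Prod>U * q) \<le> x \<longrightarrow> \<Prod>{} * \<Prod>U * q \<in> A) \<Longrightarrow>
     c1 * (d * x / sqrt (loglog x)) \<le> real (card A)"
    using card_ge_of_below[OF T(1), of "{}"] unfolding Y_def w_def by (metis empty_iff finite.emptyI)
  obtain c2 x2 where c2: "c2 > 0" and bd2: "\<And>x s d A. x \<ge> x2 \<Longrightarrow> \<bar>s\<bar> = 1 \<Longrightarrow> 1 \<le> d \<Longrightarrow> d \<le> sqrt (loglog x) + 1 \<Longrightarrow>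
      finite A \<Longrightarrow> (\<forall>U q. (\<forall>p\<in>U. prime p \<and> T < p \<and> p \<le> Y x) \<longrightarrow> below s (prime_prob w) (Suc T) (Suc (Y x)) d U \<longrightarrow>
        prime q \<longrightarrow> sqrt x < real q \<longrightarrow> real (\<Prod>V * \<Prod>U * q) \<le> x \<longrightarrow> \<Prod>V * \<Prod>U * q \<in> A) \<Longrightarrow>
     c2 * (d * x / sqrt (loglog x)) \<le> real (card A)"
    using card_ge_of_below[OF T(1) V] unfolding Y_def w_def by metis
  have "eventually (\<lambda>x::real. x \<ge> 2) at_top"
       "eventually (\<lambda>x::real. ln (ln x) \<ge> 1) at_top"
       "eventually (\<lambda>x::real. x powr \<delta> \<ge> real T + 1) at_top"
    unfolding \<delta>_def by real_asymp+
  hence "eventually (\<lambda>x::real. x \<ge> 2 \<and> ln (ln x) \<ge> 1 \<and> x powr \<delta> \<ge> real T + 1) at_top"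
    by eventually_elim auto
  then obtain x3 :: real where x3: "\<And>x. x \<ge> x3 \<Longrightarrow> x \<ge> 2 \<and> ln (ln x) \<ge> 1 \<and> x powr \<delta> \<ge> real T + 1"
    unfolding eventually_at_top_linorder by blast
  have main: "min c1 c2 * ((\<beta> + 1) * x / sqrt (loglog x)) \<le> real (card (upper_barrier_set x \<beta>)) \<and>
     min c1 c2 * ((\<beta> + 1) * x / sqrt (loglog x)) \<le> real (card (lower_barrier_set x \<beta>))"
    if x: "x \<ge> max x1 (max x2 x3)" and \<beta>: "0 \<le> \<beta>" "\<beta> \<le> sqrt (loglog x)" for x \<beta>
  proof -
    have x2: "x \<ge> 2" "loglog x \<ge> 1" "x powr \<delta> \<ge> real T + 1" using x3[of x] x by (auto simp: loglog_def)
    define y where "y = Y x"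
    have y_eq: "y = nat \<lfloor>x powr \<delta>\<rfloor>" by (simp add: y_def Y_def \<delta>_def)
    have xd2: "x powr \<delta> \<ge> 2" using x2 T by linarith
    note yb = lnln_floor[OF xd2, folded y_eq]
    have Ty: "T \<le> y" using x2 yb by linarith
    have "x powr \<delta> \<le> x powr (1 / 2)" using x2 by (intro powr_mono) (auto simp: \<delta>_def)
    hence y_le: "real y \<le> sqrt x" using yb(2) x2 by (simp add: powr_half_sqrt)
    have lnlny: "ln (ln (real y)) \<ge> loglog x + ln \<delta> - 1"
    proof -
      have "ln (ln (x powr \<delta>)) = ln (\<delta> * ln x)" using x2 by (simp add: ln_powr)
      also have "\<dots> = ln \<delta> + ln (ln x)" using x2 by (subst ln_mult_pos) (auto simp: \<delta>_def)
      finally show ?thesis using yb(5) by (simp add: loglog_def)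
    qed
    have \<delta>: "ln \<delta> < 0" by (simp add: \<delta>_def)
    have q_big: "q \<noteq> p" if "sqrt x < real q" "p \<le> y" for p q :: nat
      using that y_le by auto
    have V_le: "p \<le> y" if "p \<in> V" for p using that Ty by (simp add: V_def)
    have small: "finite U" if "\<forall>p\<in>U. prime p \<and> T < p \<and> p \<le> y" for U
      using that by (intro finite_subset[of U "{..y}"]) auto
    have n1: "\<Prod>W * \<Prod>U * q \<ge> 1" if "\<And>p. p \<in> W \<Longrightarrow> prime p" "\<forall>p\<in>U. prime p \<and> T < p \<and> p \<le> y" "prime q" for W U :: "nat set" and q
    proof -
      have "\<Prod>W \<ge> 1" "\<Prod>U \<ge> 1"
        using that by (intro prod_ge_1; auto simp: Suc_le_eq prime_gt_0_nat)+
      thus ?thesis using prime_gt_0_nat[OF that(3)] by (simp add: Suc_le_eq)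
    qed
    have up: "\<Prod>{} * \<Prod>U * q \<in> upper_barrier_set x \<beta>"
      if U: "\<forall>p\<in>U. prime p \<and> T < p \<and> p \<le> y" and bel: "below 1 (prime_prob w) (Suc T) (Suc y) (\<beta> + 1) U"
        and q: "prime q" "sqrt x < real q" and nx: "real (\<Prod>{} * \<Prod>U * q) \<le> x" for U q
    proof -
      have "real (omega (\<Prod>{} * \<Prod>U * q) t) \<le> max 0 (loglog t + \<beta>)" if t: "2 \<le> t" "t \<le> x" for t
      proof -
        define n where "n = nat \<lfloor>t\<rfloor>"
        define j where "j = min n y"
        note n = lnln_floor[OF t(1), folded n_def]
        have om: "real (omega (\<Prod>{} * \<Prod>U * q) t) = real (card (U \<inter> {Suc T..<Suc j})) + (if real q \<le> t then 1 else 0)"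
        proof -
          have "omega (\<Prod>{} * \<Prod>U * q) t = card {p\<in>{}. real p \<le> t} + card {p\<in>U. real p \<le> t} + (if real q \<le> t then 1 else 0)"
            by (rule omega_product) (use U small[OF U] q q_big in auto)
          also have "card {p\<in>U. real p \<le> t} = card (U \<inter> {Suc T..<Suc j})"
            unfolding j_def n_def by (rule card_prefix) (use U t in auto)
          finally show ?thesis by simp
        qed
        show ?thesis
        proof (cases "T \<le> n")
          \<comment> \<open>Before T there are no prime factors, so the barrier holds thanks to its
            maximum with 0.\<close>
          case False
          hence "real n + 1 \<le> real y" using Ty by linarith
          hence "\<not> real q \<le> t" using n(3) q y_le by linarith
          moreover have "U \<inter> {Suc T..<Suc j} = {}" using False by (auto simp: j_def)
          ultimately show ?thesis unfolding om by simp
        next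
          case True
          hence j: "T \<le> j" "j \<le> y" "j \<le> n" using Ty by (auto simp: j_def)
          define D where "D = (\<Sum>i\<in>{Suc T..<Suc j}. prime_prob w i)"
          define k where "k = real (card (U \<inter> {Suc T..<Suc j}))"
          have "Suc j \<in> {Suc T..Suc y}" using j by simp
          hence "1 * (k - D) \<le> \<beta> + 1"
            using bel unfolding below_def k_def D_def by blast
          hence "k \<le> D + \<beta> + 1" by simp
          moreover have "ln (ln (real j)) \<le> ln (ln (real n))"
            using j T(1) by simp
          moreover have "D \<le> ln (ln (real j)) - ln (ln (real T)) + K"
            using K[OF T(1) j(1)] unfolding D_def abs_le_iff by linarith
          ultimately have "k + 1 \<le> loglog t + \<beta>"
            using n(4) T(2) unfolding loglog_def by linarith
          hence "real (card (U \<inter> {Suc T..<Suc j})) + 1 \<le> loglog t + \<beta>" by (simp only: k_def)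
          thus ?thesis unfolding om by auto
        qed
      qed
      thus ?thesis using n1[of "{}" U q] U q nx unfolding upper_barrier_set_def by auto
    qed
    have lo: "\<Prod>V * \<Prod>U * q \<in> lower_barrier_set x \<beta>"
      if U: "\<forall>p\<in>U. prime p \<and> T < p \<and> p \<le> y" and bel: "below (-1) (prime_prob w) (Suc T) (Suc y) (\<beta> + 1) U"
        and q: "prime q" "sqrt x < real q" and nx: "real (\<Prod>V * \<Prod>U * q) \<le> x" for U q
    proof -
      have "real (omega (\<Prod>V * \<Prod>U * q) t) \<ge> loglog t - \<beta>" if t: "2 \<le> t" "t \<le> x" for t
      proof -
        define n where "n = nat \<lfloor>t\<rfloor>"
        define j where "j = min n y"
        note n = lnln_floor[OF t(1), folded n_def]
        have om: "real (omega (\<Prod>V * \<Prod>U * q) t) \<ge> real (card {p\<in>V. real p \<le> t}) + real (card (U \<inter> {Suc T..<Suc j}))"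
        proof -
          have "omega (\<Prod>V * \<Prod>U * q) t = card {p\<in>V. real p \<le> t} + card {p\<in>U. real p \<le> t} + (if real q \<le> t then 1 else 0)"
          proof (rule omega_product)
            show "V \<inter> U = {}" using U by (auto simp: V_def)
            show "q \<notin> V \<union> U" using q_big[OF q(2)] V_le U by blast
          qed (use U small[OF U] q V in auto)
          also have "card {p\<in>U. real p \<le> t} = card (U \<inter> {Suc T..<Suc j})"
            unfolding j_def n_def by (rule card_prefix) (use U t in auto)
          finally show ?thesis by simp
        qed
        show ?thesis
        proof (cases "T \<le> n")
          \<comment> \<open>Before T every prime up to t divides the integer, and
            \<open>card_primes_ge_lnln\<close> applies.\<close>
          case False
          have "{p\<in>V. real p \<le> t} = {p. prime p \<and> real p \<le> t}"
          proof -
            have "p \<le> T" if "real p \<le> t" for p using that False n(3) by linarith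
            thus ?thesis by (auto simp: V_def)
          qed
          thus ?thesis using om card_primes_ge_lnln[OF t(1)] \<beta> by simp
        next
          case True
          hence j: "T \<le> j" "j \<le> y" using Ty by (auto simp: j_def)
          have "real p \<le> t" if "p \<in> V" for p using that True n(2) by (auto simp: V_def)
          hence "{p\<in>V. real p \<le> t} = V" by auto
          hence om': "real (omega (\<Prod>V * \<Prod>U * q) t) \<ge> real (card V) + real (card (U \<inter> {Suc T..<Suc j}))"
            using om by simp
          define D where "D = (\<Sum>i\<in>{Suc T..<Suc j}. prime_prob w i)"
          define k where "k = real (card (U \<inter> {Suc T..<Suc j}))"
          have "Suc j \<in> {Suc T..Suc y}" using j by simp
          hence "-1 * (k - D) \<le> \<beta> + 1"
            using bel unfolding below_def k_def D_def by blast
          hence "D - k \<le> \<beta> + 1" by simp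
          moreover have "D \<ge> ln (ln (real j)) - ln (ln (real T)) - K"
            using K[OF T(1) j(1)] unfolding D_def abs_le_iff by linarith
          \<comment> \<open>Beyond y the count from U is frozen at j = y, but up to t = x the clock
            advances by at most -ln \<delta>, apart from rounding.\<close>
          moreover have "ln (ln (real j)) \<ge> loglog t + ln \<delta> - 1"
          proof (cases "n \<le> y")
            case True
            thus ?thesis using n(5) \<delta> by (simp add: j_def loglog_def)
          next
            case False
            have "loglog t \<le> loglog x" using t by (simp add: loglog_def)
            thus ?thesis using False lnlny by (simp add: j_def)
          qed
          ultimately show ?thesis
            using om'[folded k_def] cardV by linarith
        qed
      qed
      thus ?thesis using n1[of V U q] V U q nx unfolding lower_barrier_set_def by auto
    qed
    have fin: "finite (upper_barrier_set x \<beta>)" "finite (lower_barrier_set x \<beta>)"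
      by (rule finite_subset[OF upper_barrier_set_subset[OF \<beta>(1)] finite_barrier],
          rule finite_subset[OF lower_barrier_set_subset finite_barrier])
    have nn: "0 \<le> (\<beta> + 1) * x / sqrt (loglog x)" using \<beta> x2 by simp
    have "c1 * ((\<beta> + 1) * x / sqrt (loglog x)) \<le> real (card (upper_barrier_set x \<beta>))"
    proof (rule bd1[of x 1])
      show "\<forall>U q. (\<forall>p\<in>U. prime p \<and> T < p \<and> p \<le> Y x) \<longrightarrow> below 1 (prime_prob w) (Suc T) (Suc (Y x)) (\<beta> + 1) U \<longrightarrow>
        prime q \<longrightarrow> sqrt x < real q \<longrightarrow> real (\<Prod>{} * \<Prod>U * q) \<le> x \<longrightarrow> \<Prod>{} * \<Prod>U * q \<in> upper_barrier_set x \<beta>"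
        by (intro allI impI up) (simp_all only: y_def)
    qed (use x \<beta> fin(1) in simp_all)
    moreover have "c2 * ((\<beta> + 1) * x / sqrt (loglog x)) \<le> real (card (lower_barrier_set x \<beta>))"
    proof (rule bd2[of x "-1"])
      show "\<forall>U q. (\<forall>p\<in>U. prime p \<and> T < p \<and> p \<le> Y x) \<longrightarrow> below (-1) (prime_prob w) (Suc T) (Suc (Y x)) (\<beta> + 1) U \<longrightarrow>
        prime q \<longrightarrow> sqrt x < real q \<longrightarrow> real (\<Prod>V * \<Prod>U * q) \<le> x \<longrightarrow> \<Prod>V * \<Prod>U * q \<in> lower_barrier_set x \<beta>"
        by (intro allI impI lo) (simp_all only: y_def)
    qed (use x \<beta> fin(2) in simp_all)
    moreover have "min c1 c2 * ((\<beta> + 1) * x / sqrt (loglog x)) \<le> c1 * ((\<beta> + 1) * x / sqrt (loglog x))"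
      "min c1 c2 * ((\<beta> + 1) * x / sqrt (loglog x)) \<le> c2 * ((\<beta> + 1) * x / sqrt (loglog x))"
      using nn by (intro mult_right_mono; simp)+
    ultimately show ?thesis by linarith
  qed
  show ?thesis
  proof (rule exI[of _ "min c1 c2"], rule conjI)
    show "min c1 c2 > 0" using c1 c2 by simp
  qed (rule exI[of _ "max x1 (max x2 x3)"], use main in blast)
qed

theorem corollary1:
  "\<exists>x\<^sub>0 c\<^sub>1 c\<^sub>2 :: real. 0 < c\<^sub>1 \<and> c\<^sub>1 \<le> c\<^sub>2 \<and>
     (\<forall>x \<beta> :: real. x \<ge> x\<^sub>0 \<longrightarrow> 0 \<le> \<beta> \<longrightarrow> \<beta> \<le> sqrt (loglog x) \<longrightarrow>
        c\<^sub>1 * ((\<beta> + 1) * x / sqrt (loglog x)) \<le> real (card (upper_barrier_set x \<beta>)) \<and>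
        real (card (upper_barrier_set x \<beta>)) \<le> c\<^sub>2 * ((\<beta> + 1) * x / sqrt (loglog x)) \<and>
        c\<^sub>1 * ((\<beta> + 1) * x / sqrt (loglog x)) \<le> real (card (lower_barrier_set x \<beta>)) \<and>
        real (card (lower_barrier_set x \<beta>)) \<le> c\<^sub>2 * ((\<beta> + 1) * x / sqrt (loglog x)))"
proof -
  obtain c x1 where c: "c > 0" and lower: "\<And>x \<beta>. x \<ge> x1 \<Longrightarrow> 0 \<le> \<beta> \<Longrightarrow> \<beta> \<le> sqrt (loglog x) \<Longrightarrow>
     c * ((\<beta> + 1) * x / sqrt (loglog x)) \<le> real (card (upper_barrier_set x \<beta>)) \<and>
     c * ((\<beta> + 1) * x / sqrt (loglog x)) \<le> real (card (lower_barrier_set x \<beta>))"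
    using card_barrier_sets_ge by blast
  obtain C x2 where C: "C > 0" and upper: "\<And>x s d. x \<ge> x2 \<Longrightarrow> \<bar>s\<bar> = 1 \<Longrightarrow> d \<ge> 0 \<Longrightarrow>
     real (card (barrier s x d)) \<le> C * ((d + 1) * x / sqrt (loglog x))"
    using card_barrier_le by blast
  have "eventually (\<lambda>x::real. x \<ge> 0 \<and> ln (ln x) \<ge> 1) at_top"
    by (intro eventually_conj; real_asymp)
  then obtain x3 :: real where x3: "\<And>x. x \<ge> x3 \<Longrightarrow> x \<ge> 0 \<and> ln (ln x) \<ge> 1"
    unfolding eventually_at_top_linorder by blast
  \<comment> \<open>The factor 2 comes from \<beta> + 2 \<le> 2 (\<beta> + 1), and the maximum with
    c ensures that the lower constant does not exceed the upper one.\<close>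
  have up: "real (card A) \<le> max c (2 * C) * ((\<beta> + 1) * x / sqrt (loglog x))"
    if x: "x \<ge> max x1 (max x2 x3)" and \<beta>: "0 \<le> \<beta>" and s: "\<bar>s\<bar> = 1" and A: "A \<subseteq> barrier s x (\<beta> + 1)" for x \<beta> s A
  proof -
    have x0: "x \<ge> 0" "loglog x \<ge> 1" using x3[of x] x by (auto simp: loglog_def)
    have "real (card A) \<le> real (card (barrier s x (\<beta> + 1)))"
      using A by (intro of_nat_mono card_mono) auto
    also have "\<dots> \<le> C * ((\<beta> + 1 + 1) * x / sqrt (loglog x))"
      using x s \<beta> by (intro upper) auto
    also have "\<dots> \<le> C * ((2 * (\<beta> + 1)) * x / sqrt (loglog x))"
      using C x0 \<beta> by (intro mult_left_mono divide_right_mono mult_right_mono) auto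
    also have "\<dots> = (2 * C) * ((\<beta> + 1) * x / sqrt (loglog x))" by (simp add: algebra_simps)
    also have "\<dots> \<le> max c (2 * C) * ((\<beta> + 1) * x / sqrt (loglog x))"
      using x0 \<beta> by (intro mult_right_mono divide_nonneg_nonneg mult_nonneg_nonneg) auto
    finally show ?thesis .
  qed
  show ?thesis
  proof (rule exI[of _ "max x1 (max x2 x3)"], rule exI[of _ c], rule exI[of _ "max c (2 * C)"], intro conjI allI impI)
    fix x \<beta> :: real
    assume x: "x \<ge> max x1 (max x2 x3)" and \<beta>: "0 \<le> \<beta>" "\<beta> \<le> sqrt (loglog x)"
    have "x \<ge> x1" using x by simp
    thus "c * ((\<beta> + 1) * x / sqrt (loglog x)) \<le> real (card (upper_barrier_set x \<beta>))"
      "c * ((\<beta> + 1) * x / sqrt (loglog x)) \<le> real (card (lower_barrier_set x \<beta>))"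
      using lower[OF _ \<beta>] by blast+
    show "real (card (upper_barrier_set x \<beta>)) \<le> max c (2 * C) * ((\<beta> + 1) * x / sqrt (loglog x))"
      using up[OF x \<beta>(1) _ upper_barrier_set_subset[OF \<beta>(1)]] by simp
    show "real (card (lower_barrier_set x \<beta>)) \<le> max c (2 * C) * ((\<beta> + 1) * x / sqrt (loglog x))"
      using up[OF x \<beta>(1) _ lower_barrier_set_subset] by simp
  qed (use c in auto)
qed

end
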